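(* Let $k\ge0$ be an integer and let $E_1,\dots,E_{n-1}$ and $D$ be polynomials such that $\deg(E_i)\le pk$ for $1\le i\le n-1$, $\deg(D)\le k$, $D(z)\neq0$ for every $z\in\overline{\mathbb D}$, and $E_i=E_{n-i}^{\sim pk}$ for $1\le i\le n-1$. Define $\theta_i=\dfrac{E_i}{D^p}$ for $1\le i\le n-1$ and $\theta_n=\dfrac{D^{\sim k}}{D}$. Suppose that $$(\gamma_1\theta_1(z),\dots,\gamma_{n-1}\theta_{n-1}(z))\in\Gamma_{n-1}\quad\text{for every }z\in\mathbb T,$$ where $\gamma_i=\frac{n-i}{n}$ for $1\le i\le n-1$. Then $\Theta=(\theta_1,\dots,\theta_n)$ is a rational $\mathbf{\Theta}_n$-inner function of degree at most $pk$.
   Context: $\mathbb D$ is the open unit disc, $\mathbb T$ the unit circle. Fix positive integers $m,p$ with $p$ dividing $m$, and $n\ge2$. Let $s_i$ denote the $i$-th elementary symmetric polynomial; for $d\ge1$, $\Gamma_d=\{(s_1(z),\dots,s_d(z)):z\in\overline{\mathbb D}^d\}$ is the closed symmetrized polydisc. Define $\theta=(\theta_1,\dots,\theta_n):\mathbb C^n\to\mathbb C^n$ by $\theta_i(z)=s_i(z_1^m,\dots,z_n^m)$ for $1\le i\le n-1$ and $\theta_n(z)=(z_1\cdots z_n)^{m/p}$, and set $\mathbf{\Theta}_n=\theta(\mathbb D^n)$, $\overline{\mathbf{\Theta}}_n=\theta(\overline{\mathbb D}^n)$. The distinguished boundary $b\mathbf{\Theta}_n$ is the Shilov boundary of $\overline{\mathbf{\Theta}}_n$,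 i.e. the smallest closed subset of $\overline{\mathbf{\Theta}}_n$ on which every function continuous on $\overline{\mathbf{\Theta}}_n$ and holomorphic in $\mathbf{\Theta}_n$ attains its maximum modulus (it is known to equal $\theta(\mathbb T^n)$). A $\mathbf{\Theta}_n$-inner function is a holomorphic map $\Theta:\mathbb D\to\overline{\mathbf{\Theta}}_n$ such that $\lim_{r\to1^-}\Theta(r\zeta)\in b\mathbf{\Theta}_n$ for Lebesgue-a.e. $\zeta\in\mathbb T$; it is rational if all its components are rational functions. For a rational $\mathbf{\Theta}_n$-inner function, $\theta_n$ is a finite Blaschke product, its degree is its number of Blaschke factors, and $\deg(\Theta):=p\deg(\theta_n)$. For a polynomial $h$ of degree at most $d$, $h^{\sim d}(z)=z^d\,\overline{h(1/\overline z)}$. *)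

theory Defs
  imports "HOL-Complex_Analysis.Complex_Analysis" "HOL-Library.FuncSet"
begin

text \<open>
  \<open>\<complex>\<^sup>n\<close> is rendered as \<open>complex ^ 'n\<close> with \<open>n = CARD('n)\<close>. The index type is linearly ordered, and
  the coordinates are numbered \<open>1, \<dots>, n\<close> by their rank in that order.
\<close>

definition coord :: "'n::{finite,linorder} \<Rightarrow> nat"
  where "coord i = card {..i}"

lemma coord_less: "i < j \<Longrightarrow> coord i < coord (j :: 'n::{finite,linorder})"
  unfolding coord_def by (rule psubset_card_mono) auto

lemma inj_coord: "inj (coord :: 'n::{finite,linorder} \<Rightarrow> nat)"
  by (rule linorder_injI) (use coord_less in \<open>metis less_irrefl\<close>)

lemma bij_coord: "bij_betw coord (UNIV :: 'n::{finite,linorder} set) {1..CARD('n)}"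
proof -
  have "coord i \<in> {1..CARD('n)}" for i :: 'n
    by (auto simp: coord_def Suc_le_eq card_gt_0_iff intro: card_mono)
  then have "range (coord :: 'n \<Rightarrow> nat) = {1..CARD('n)}"
    by (intro card_subset_eq) (auto simp del: atLeastAtMost_iff simp: card_image inj_coord)
  then show ?thesis
    using inj_coord by (auto simp: bij_betw_def)
qed

lemma coord_Max: "coord (Max UNIV :: 'n::{finite,linorder}) = CARD('n)"
proof -
  have "{..Max UNIV :: 'n} = UNIV" by auto
  then show ?thesis by (simp add: coord_def)
qed

definition elem_sym :: "'i set \<Rightarrow> nat \<Rightarrow> ('i \<Rightarrow> complex) \<Rightarrow> complex"
  where "elem_sym I i z = (\<Sum>S | S \<subseteq> I \<and> card S = i. \<Prod>j\<in>S. z j)"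

text \<open>
  The closed symmetrized polydisc lives in dimension \<open>n - 1\<close> as well as \<open>n\<close>, so its points are
  extensional functions on \<open>{1..d}\<close>.
\<close>

definition sym_polydisc :: "nat \<Rightarrow> (nat \<Rightarrow> complex) set"
  where "sym_polydisc d =
    {(\<lambda>i\<in>{1..d}. elem_sym {1..d} i z) | z. z \<in> {1..d} \<rightarrow>\<^sub>E cball 0 1}"

definition theta_map :: "nat \<Rightarrow> nat \<Rightarrow> complex ^ 'n::{finite,linorder} \<Rightarrow> complex ^ 'n::{finite,linorder}"
  where "theta_map m p z =
    (\<chi> i. if coord i < CARD('n) then elem_sym UNIV (coord i) (\<lambda>j. (z $ j) ^ m)
          else (\<Prod>j\<in>UNIV. z $ j) ^ (m div p))"

definition Theta_open :: "nat \<Rightarrow> nat \<Rightarrow> (complex ^ 'n::{finite,linorder}) set"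
  where "Theta_open m p = theta_map m p ` {z. \<forall>j. z $ j \<in> ball 0 1}"

definition Theta_closed :: "nat \<Rightarrow> nat \<Rightarrow> (complex ^ 'n::{finite,linorder}) set"
  where "Theta_closed m p = theta_map m p ` {z. \<forall>j. z $ j \<in> cball 0 1}"

text \<open>Holomorphy in several variables: the derivative exists and is complex linear.\<close>

definition holomorphic_vec_on :: "(complex ^ 'n::finite \<Rightarrow> complex) \<Rightarrow> (complex ^ 'n::finite) set \<Rightarrow> bool"
  where "holomorphic_vec_on f U \<longleftrightarrow>
    (\<forall>x\<in>U. \<exists>f'. (f has_derivative f') (at x within U) \<and> (\<forall>c v. f' (c *s v) = c * f' v))"

definition closed_boundary ::
    "(complex ^ 'n::finite) set \<Rightarrow> (complex ^ 'n::finite) set \<Rightarrow> (complex ^ 'n::finite) set \<Rightarrow> bool"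
  where "closed_boundary U K S \<longleftrightarrow>
    closed S \<and> S \<subseteq> K \<and>
    (\<forall>f. continuous_on K f \<and> holomorphic_vec_on f U \<longrightarrow>
      (\<exists>x\<in>S. \<forall>y\<in>K. norm (f y) \<le> norm (f x)))"

definition Shilov_boundary :: "(complex ^ 'n::finite) set \<Rightarrow> (complex ^ 'n::finite) set \<Rightarrow> (complex ^ 'n::finite) set"
  where "Shilov_boundary U K = (LEAST S. closed_boundary U K S)"

definition Theta_boundary :: "nat \<Rightarrow> nat \<Rightarrow> (complex ^ 'n::{finite,linorder}) set"
  where "Theta_boundary m p = Shilov_boundary (Theta_open m p) (Theta_closed m p)"

definition Theta_inner :: "nat \<Rightarrow> nat \<Rightarrow> (complex \<Rightarrow> complex ^ 'n::{finite,linorder}) \<Rightarrow> bool"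
  where "Theta_inner m p F \<longleftrightarrow>
    (\<forall>j. (\<lambda>z. F z $ j) holomorphic_on ball 0 1) \<and>
    F ` ball 0 1 \<subseteq> Theta_closed m p \<and>
    (AE t in lebesgue_on {0..2 * pi}.
      \<exists>l\<in>Theta_boundary m p. ((\<lambda>r. F (complex_of_real r * cis t)) \<longlongrightarrow> l) (at_left 1))"

definition rational_on_disc :: "(complex \<Rightarrow> complex) \<Rightarrow> bool"
  where "rational_on_disc f \<longleftrightarrow>
    (\<exists>P Q. \<forall>z\<in>ball 0 1. poly Q z \<noteq> 0 \<and> f z = poly P z / poly Q z)"

definition rational_Theta_inner ::
    "nat \<Rightarrow> nat \<Rightarrow> (complex \<Rightarrow> complex ^ 'n::{finite,linorder}) \<Rightarrow> bool"
  where "rational_Theta_inner m p F \<longleftrightarrow>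
    Theta_inner m p F \<and> (\<forall>j. rational_on_disc (\<lambda>z. F z $ j))"

definition finite_Blaschke_product :: "(complex \<Rightarrow> complex) \<Rightarrow> nat \<Rightarrow> bool"
  where "finite_Blaschke_product f N \<longleftrightarrow>
    (\<exists>c a. norm c = 1 \<and> (\<forall>j<N. norm (a j) < 1) \<and>
      (\<forall>z\<in>ball 0 1. f z = c * (\<Prod>j<N. (z - a j) / (1 - cnj (a j) * z))))"

definition Blaschke_degree :: "(complex \<Rightarrow> complex) \<Rightarrow> nat"
  where "Blaschke_degree f = (THE N. finite_Blaschke_product f N)"

text \<open>By \<open>coord_Max\<close>, \<open>Max UNIV\<close> is the index of the last coordinate.\<close>

definition Theta_degree :: "nat \<Rightarrow> (complex \<Rightarrow> complex ^ 'n::{finite,linorder}) \<Rightarrow> nat"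
  where "Theta_degree p F = p * Blaschke_degree (\<lambda>z. F z $ Max UNIV)"

text \<open>
  The reflected polynomial \<open>z\<^sup>d * cnj (h (1 / cnj z))\<close>, given by its coefficients so that it is also
  defined at 0; see the lemma below.
\<close>

definition reflected :: "nat \<Rightarrow> complex poly \<Rightarrow> complex poly"
  where "reflected d h = (\<Sum>j\<le>d. monom (cnj (coeff h (d - j))) j)"

lemma poly_reflected:
  assumes "degree h \<le> d" "z \<noteq> 0"
  shows "poly (reflected d h) z = z ^ d * cnj (poly h (1 / cnj z))"
proof -
  have "poly (reflected d h) z = (\<Sum>j\<le>d. cnj (coeff h (d - j)) * z ^ j)"
    by (simp add: reflected_def poly_sum poly_monom)
  also have "\<dots> = (\<Sum>j\<le>d. cnj (coeff h j) * z ^ (d - j))"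
    by (rule sum.reindex_bij_witness[where i = "\<lambda>j. d - j" and j = "\<lambda>j. d - j"]) auto
  also have "\<dots> = (\<Sum>j\<le>d. z ^ d * cnj (coeff h j * (1 / cnj z) ^ j))"
    using assms(2) by (intro sum.cong) (auto simp: power_diff field_simps)
  also have "\<dots> = z ^ d * cnj (\<Sum>j\<le>d. coeff h j * (1 / cnj z) ^ j)"
    by (simp add: sum_distrib_left)
  also have "(\<Sum>j\<le>d. coeff h j * (1 / cnj z) ^ j) = poly h (1 / cnj z)"
    unfolding poly_altdef using assms(1)
    by (intro sum.mono_neutral_right) (auto simp: coeff_eq_0)
  finally show ?thesis .
qed

end

theory Submission
  imports Defs "HOL-Computational_Algebra.Fundamental_Theorem_Algebra"
begin

text \<open>
  Attach to \<open>z\<close> the monic polynomial \<open>P\<^sub>z(w) = w\<^sup>n - \<theta>\<^sub>1(z) w\<^sup>n\<^sup>-\<^sup>1 + \<dots> + (-1)\<^sup>n \<theta>\<^sub>n(z)\<^sup>p\<close>. A point of \<open>\<complex>\<^sup>n\<close>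
  is in the image of the closed polydisc (of the torus) exactly when the roots of its polynomial are
  in the closed disc (on the circle): the roots are the \<open>m\<close>-th powers of the coordinates of a
  preimage, and the \<open>m\<close>-th roots can be chosen to fit the last coordinate
  (\<open>exists_theta_map_fibre\<close>). So everything is a question about the roots of \<open>P\<^sub>z\<close>.

  For \<open>z\<close> on the unit circle, the symmetry of the \<open>E\<^sub>i\<close> makes \<open>P\<^sub>z\<close> self-inversive, and the weights
  \<open>\<gamma>\<^sub>i = (n - i) / n\<close> are such that the \<open>\<gamma>\<^sub>i \<theta>\<^sub>i(z)\<close> are, up to sign, the coefficients of \<open>P\<^sub>z' / n\<close>. The hypothesis
  therefore says that the critical points of \<open>P\<^sub>z\<close> lie in the closed disc, and by Cohn's theorem
  (\<open>roots_on_circle_of_critical_points_in_disc\<close>) all roots of \<open>P\<^sub>z\<close> lie on the circle. Since the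
  coefficients are holomorphic in \<open>z\<close>, a maximum principle
  (\<open>roots_in_disc_of_roots_on_circle\<close>) keeps the roots in the closed disc for \<open>z\<close> inside the disc.

  The distinguished boundary is defined as the least closed boundary, so it has to be identified
  with the image of the torus. That this image is a closed boundary is the maximum principle on
  the polydisc (\<open>torus_is_closed_boundary\<close>); that it is the least one requires functions of the
  coordinates which peak, in the limit, at a prescribed point of it
  (\<open>torus_subset_closed_boundary\<close>). Finally \<open>\<theta>\<^sub>n\<close> is a Blaschke product with exactly \<open>k\<close> factors
  (\<open>finite_Blaschke_product_reflected\<close>).
\<close>

(* The dollar sign denotes vector components throughout, never coefficients of power series. *)
no_notation fps_nth (infixl \<open>$\<close> 75)

section \<open>Polynomials and the elementary symmetric functions of their roots\<close>

text \<open>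
  The expansion is kept homogeneous in \<open>x\<close> and \<open>y\<close> so that it serves both for the polynomial
  \<open>\<Prod>(w - u\<^sub>j)\<close> and for its reversal \<open>\<Prod>(1 - t u\<^sub>j)\<close>.
\<close>

lemma prod_add_mult_eq_sum_elem_sym:
  fixes x y :: complex
  assumes "finite I"
  shows "(\<Prod>j\<in>I. x + y * b j) = (\<Sum>i\<le>card I. elem_sym I i b * x ^ (card I - i) * y ^ i)"
proof -
  have "(\<Prod>j\<in>I. y * b j + x) = (\<Sum>S\<in>Pow I. (\<Prod>j\<in>S. y * b j) * (\<Prod>j\<in>I - S. x))"
    by (rule prod_add) (fact assms)
  also have "\<dots> = (\<Sum>S\<in>Pow I. (\<Prod>j\<in>S. b j) * x ^ (card I - card S) * y ^ card S)"
    using assms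
    by (intro sum.cong) (auto simp: prod.distrib card_Diff_subset finite_subset)
  also have "\<dots> = (\<Sum>i\<le>card I. \<Sum>S | S \<in> Pow I \<and> card S = i.
      (\<Prod>j\<in>S. b j) * x ^ (card I - card S) * y ^ card S)"
    by (rule sum.group[symmetric]) (use assms in \<open>auto intro: card_mono\<close>)
  also have "\<dots> = (\<Sum>i\<le>card I. elem_sym I i b * x ^ (card I - i) * y ^ i)"
    by (intro sum.cong) (auto simp: elem_sym_def sum_distrib_right)
  finally show ?thesis
    by (simp add: add.commute)
qed

lemma elem_sym_0 [simp]: "finite I \<Longrightarrow> elem_sym I 0 b = 1"
proof -
  assume "finite I"
  then have "{S. S \<subseteq> I \<and> card S = 0} = {{}}"
    by (auto dest: finite_subset)
  then show ?thesis by (simp add: elem_sym_def)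
qed

lemma elem_sym_card: "finite I \<Longrightarrow> elem_sym I (card I) b = (\<Prod>j\<in>I. b j)"
proof -
  assume "finite I"
  then have "{S. S \<subseteq> I \<and> card S = card I} = {I}"
    by (auto dest: card_subset_eq)
  then show ?thesis by (simp add: elem_sym_def)
qed

lemma elem_sym_permute:
  assumes "bij_betw \<phi> I I"
  shows "elem_sym I i (b \<circ> \<phi>) = elem_sym I i b"
proof -
  have inj: "inj_on \<phi> S" if "S \<subseteq> I" for S
    using assms that by (auto simp: bij_betw_def intro: inj_on_subset)
  have "bij_betw ((`) \<phi>) (Pow I) (Pow I)"
    by (rule bij_betw_Pow) (fact assms)
  moreover have "card (\<phi> ` S) = card S" if "S \<in> Pow I" for S
    using inj that by (auto intro: card_image)
  ultimately have "bij_betw ((`) \<phi>) {S \<in> Pow I. card S = i} {S \<in> Pow I. card S = i}"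
    by (intro bij_betw_Collect) auto
  then have "elem_sym I i b = (\<Sum>S | S \<in> Pow I \<and> card S = i. \<Prod>j\<in>\<phi> ` S. b j)"
    unfolding elem_sym_def by (subst sum.reindex_bij_betw[symmetric]) auto
  also have "\<dots> = elem_sym I i (b \<circ> \<phi>)"
    unfolding elem_sym_def by (intro sum.cong) (auto simp: prod.reindex[OF inj])
  finally show ?thesis ..
qed

lemma continuous_elem_sym:
  assumes "\<And>j. j \<in> I \<Longrightarrow> continuous_on A (\<lambda>x. g x j)"
  shows "continuous_on A (\<lambda>x. elem_sym I i (g x))"
  unfolding elem_sym_def by (intro continuous_intros) (use assms in auto)

text \<open>
  Over \<open>\<complex>\<close> the elementary symmetric functions jointly take all values: the required \<open>u\<^sub>j\<close> are the roots of
  the monic polynomial with coefficients \<open>(-1)\<^sup>i c\<^sub>i\<close>.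
\<close>

lemma exists_elem_sym:
  fixes c :: "nat \<Rightarrow> complex"
  assumes "c 0 = 1"
  shows "\<exists>u :: 'n::finite \<Rightarrow> complex. \<forall>i\<le>CARD('n). c i = elem_sym UNIV i u"
proof -
  define N where "N = CARD('n)"
  define P where "P = (\<Sum>i\<le>N. monom ((-1) ^ i * c i) (N - i))"
  have coeff_P: "coeff P j = (if j \<le> N then (-1) ^ (N - j) * c (N - j) else 0)" for j
  proof -
    have "coeff P j = (\<Sum>i\<le>N. if i = N - j \<and> j \<le> N then (-1) ^ i * c i else 0)"
      unfolding P_def coeff_sum coeff_monom by (intro sum.cong) auto
    then show ?thesis by (cases "j \<le> N") (auto simp: sum.delta)
  qed
  have degP: "degree P = N"
    by (intro antisym degree_le le_degree) (use coeff_P assms in auto)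
  then have lead: "coeff P N = 1"
    using coeff_P assms by simp
  obtain root where "smult (lead_coeff P) (\<Prod>i<degree P. [:- root i, 1:]) = P"
    by (rule complex_poly_decompose')
  then have root: "(\<Prod>i<N. [:- root i, 1:]) = P"
    unfolding degP lead by (simp only: smult_1_left)
  obtain h :: "'n \<Rightarrow> nat" where h: "bij_betw h UNIV {..<N}"
    using ex_bij_betw_finite_nat[OF finite, of "UNIV :: 'n set"] unfolding N_def
    by (auto simp: atLeast0LessThan)
  define u where "u = root \<circ> h"
  have P1: "P = (\<Prod>j\<in>UNIV. [:- u j, 1:])"
    unfolding root[symmetric] u_def o_def
    by (rule prod.reindex_bij_betw[OF h, symmetric])
  define R where "R = (\<Sum>i\<le>N. monom ((-1) ^ i * elem_sym UNIV i u) (N - i))"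
  have "poly P x = poly R x" for x
  proof -
    have "poly P x = (\<Prod>j\<in>UNIV. x + (-1) * u j)"
      unfolding P1 poly_prod by simp
    also have "\<dots> = poly R x"
      unfolding prod_add_mult_eq_sum_elem_sym[OF finite] R_def poly_sum poly_monom N_def
      by (intro sum.cong) auto
    finally show ?thesis .
  qed
  then have PR: "P = R" by (simp add: poly_eq_poly_eq_iff[symmetric] ext)
  have coeff_R: "coeff R j = (if j \<le> N then (-1) ^ (N - j) * elem_sym UNIV (N - j) u else 0)" for j
  proof -
    have "coeff R j = (\<Sum>i\<le>N. if i = N - j \<and> j \<le> N then (-1) ^ i * elem_sym UNIV i u else 0)"
      unfolding R_def coeff_sum coeff_monom by (intro sum.cong) auto
    then show ?thesis by (cases "j \<le> N") (auto simp: sum.delta)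
  qed
  have "c i = elem_sym UNIV i u" if "i \<le> N" for i
    using coeff_P[of "N - i"] coeff_R[of "N - i"] PR that by simp
  then show ?thesis unfolding N_def by blast
qed

section \<open>Self-inversive polynomials with critical points in the disc\<close>

lemma norm_diff_reflected_factor:
  fixes w b :: complex
  shows "(norm (w - b))\<^sup>2 - (norm (1 - cnj b * w))\<^sup>2 = ((norm w)\<^sup>2 - 1) * (1 - (norm b)\<^sup>2)"
  unfolding cmod_power2 by (simp add: algebra_simps power2_eq_square)

lemma norm_reflected_factor_le:
  fixes w b :: complex
  assumes "norm b \<le> 1" "1 \<le> norm w"
  shows "norm (1 - cnj b * w) \<le> norm (w - b)"
proof -
  have "0 \<le> ((norm w)\<^sup>2 - 1) * (1 - (norm b)\<^sup>2)"
    using assms by (intro mult_nonneg_nonneg) (auto simp: power_le_one)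
  then have "(norm (1 - cnj b * w))\<^sup>2 \<le> (norm (w - b))\<^sup>2"
    using norm_diff_reflected_factor[of w b] by linarith
  then show ?thesis by (rule power2_le_imp_le) (rule norm_ge_zero)
qed

lemma elem_sym_cnj: "elem_sym I i (\<lambda>j. cnj (b j)) = cnj (elem_sym I i b)"
  by (simp add: elem_sym_def)

text \<open>
  Cohn's theorem on self-inversive polynomials. Let \<open>P(w) = \<Prod>(w - u\<^sub>j)\<close>, so that the hypothesis on
  \<open>b\<close> says that \<open>P'(w) = N \<Prod>(w - b\<^sub>j)\<close>. Self-inversiveness turns the polar derivative \<open>N P - w P'\<close>
  into a unimodular multiple of the reversal of \<open>P'\<close>, which gives, with \<open>c\<close> the product of all \<open>u\<^sub>j\<close>, the identity
  \<open>P(w) = w \<Prod>(w - b\<^sub>j) + (-1)\<^sup>N c \<Prod>(1 - cnj b\<^sub>j w)\<close>.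
  For \<open>\<bar>w\<bar> > 1\<close> the first summand dominates the second factor by factor, so that \<open>P\<close> has no root
  there. All roots then lie in the closed disc, and their product is unimodular.
\<close>

lemma roots_on_circle_of_critical_points_in_disc:
  fixes u :: "'n::finite \<Rightarrow> complex" and b :: "nat \<Rightarrow> complex"
  assumes N: "N = CARD('n)" 
    and cn: "norm (elem_sym UNIV N u) = 1"
    and self_inv: "\<And>i. i \<le> N \<Longrightarrow>
      elem_sym UNIV i u = cnj (elem_sym UNIV (N - i) u) * elem_sym UNIV N u"
    and b: "\<And>j. j \<in> {1..N-1} \<Longrightarrow> norm (b j) \<le> 1"
    and crit: "\<And>i. i \<le> N - 1 \<Longrightarrow>
      of_nat (N - i) / of_nat N * elem_sym UNIV i u = elem_sym {1..N-1} i b"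
  shows "norm (u j) = 1"
proof -
  define c where "c i = elem_sym UNIV i u" for i
  define B where "B i = elem_sym {1..N-1} i b" for i
  have N1: "1 \<le> N" unfolding N by simp
  then have Bc: "B i = (1 - of_nat i / of_nat N) * c i" if "i \<le> N - 1" for i
    using crit[OF that] that by (simp add: B_def c_def of_nat_diff field_simps)
  have prod_u: "(\<Prod>j\<in>UNIV. w - u j) = (\<Sum>i\<le>N. (-1) ^ i * c i * w ^ (N - i))" for w
    using prod_add_mult_eq_sum_elem_sym[OF finite, of w "-1" u]
    by (simp add: c_def N mult_ac)
  have prod_b: "(\<Prod>j\<in>{1..N-1}. w - b j) = (\<Sum>i\<le>N-1. (-1) ^ i * B i * w ^ (N - 1 - i))" for w
    using prod_add_mult_eq_sum_elem_sym[of "{1..N-1}" w "-1" b]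
    by (simp add: B_def mult_ac)
  have prod_b': "(\<Prod>j\<in>{1..N-1}. 1 - cnj (b j) * w) = (\<Sum>i\<le>N-1. (-1) ^ i * cnj (B i) * w ^ i)" for w
    using prod_add_mult_eq_sum_elem_sym[of "{1..N-1}" 1 "-w" "\<lambda>j. cnj (b j)"]
    by (simp add: B_def elem_sym_cnj mult_ac power_minus[of w])
  \<comment> \<open>The identity for \<open>P\<close>, compared coefficient by coefficient: the coefficient \<open>c\<^sub>i\<close>
      is divided into the shares \<open>(1 - i / N) c\<^sub>i\<close> and \<open>(i / N) c\<^sub>i\<close>.\<close>
  have split: "(\<Prod>j\<in>UNIV. w - u j) =
      w * (\<Prod>j\<in>{1..N-1}. w - b j) + (-1) ^ N * c N * (\<Prod>j\<in>{1..N-1}. 1 - cnj (b j) * w)" for w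
  proof -
    have "w * (\<Prod>j\<in>{1..N-1}. w - b j) = (\<Sum>i\<le>N-1. (-1) ^ i * B i * (w * w ^ (N - 1 - i)))"
      unfolding prod_b sum_distrib_left by (simp add: mult_ac)
    also have "\<dots> = (\<Sum>i\<le>N-1. (-1) ^ i * (1 - of_nat i / of_nat N) * c i * w ^ (N - i))"
    proof (intro sum.cong refl)
      fix i assume i: "i \<in> {..N-1}"
      then have "N - i = Suc (N - 1 - i)"
        using N1 by auto
      then have "w * w ^ (N - 1 - i) = w ^ (N - i)"
        by simp
      then show "(-1) ^ i * B i * (w * w ^ (N - 1 - i)) =
          (-1) ^ i * (1 - of_nat i / of_nat N) * c i * w ^ (N - i)"
        using Bc[of i] i by simp
    qed
    also have "\<dots> = (\<Sum>i\<le>N. (-1) ^ i * (1 - of_nat i / of_nat N) * c i * w ^ (N - i))"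
      using N1 by (intro sum.mono_neutral_left) (auto simp: not_le)
    finally have 1: "w * (\<Prod>j\<in>{1..N-1}. w - b j) =
      (\<Sum>i\<le>N. (-1) ^ i * (1 - of_nat i / of_nat N) * c i * w ^ (N - i))" .
    have "(-1) ^ N * c N * (\<Prod>j\<in>{1..N-1}. 1 - cnj (b j) * w) =
        (\<Sum>i\<le>N-1. (-1) ^ N * (-1) ^ i * (1 - of_nat i / of_nat N) * (cnj (c i) * c N) * w ^ i)"
      unfolding prod_b' sum_distrib_left
      by (intro sum.cong) (auto simp: Bc mult_ac)
    also have "\<dots> = (\<Sum>i\<le>N. (-1) ^ N * (-1) ^ i * (1 - of_nat i / of_nat N) * (cnj (c i) * c N) * w ^ i)"
      using N1 by (intro sum.mono_neutral_left) (auto simp: not_le)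
    also have "\<dots> = (\<Sum>i\<le>N. (-1) ^ N * (-1) ^ (N - i) * (1 - of_nat (N - i) / of_nat N) * (cnj (c (N - i)) * c N) * w ^ (N - i))"
      by (rule sum.reindex_bij_witness[where i = "\<lambda>j. N - j" and j = "\<lambda>j. N - j"]) auto
    also have "\<dots> = (\<Sum>i\<le>N. (-1) ^ i * (of_nat i / of_nat N) * c i * w ^ (N - i))"
    proof (intro sum.cong refl)
      fix i assume "i \<in> {..N}"
      then have i: "i \<le> N" by simp
      have "(-1 :: complex) ^ N * (-1) ^ (N - i) = (-1) ^ i"
        using i by (simp add: power_add[symmetric] minus_one_power_iff)
      moreover have "1 - of_nat (N - i) / of_nat N = (of_nat i / of_nat N :: complex)"
        using i N1 by (simp add: of_nat_diff field_simps)
      moreover have "cnj (c (N - i)) * c N = c i"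
        using self_inv[OF i] by (simp add: c_def)
      ultimately show "(-1) ^ N * (-1) ^ (N - i) * (1 - of_nat (N - i) / of_nat N) *
          (cnj (c (N - i)) * c N) * w ^ (N - i) = (-1) ^ i * (of_nat i / of_nat N) * c i * w ^ (N - i)"
        by simp
    qed
    finally have 2: "(-1) ^ N * c N * (\<Prod>j\<in>{1..N-1}. 1 - cnj (b j) * w) =
      (\<Sum>i\<le>N. (-1) ^ i * (of_nat i / of_nat N) * c i * w ^ (N - i))" .
    show ?thesis
      unfolding 1 2 prod_u sum.distrib[symmetric]
      by (intro sum.cong) (auto simp: algebra_simps)
  qed
  have le1: "norm (u j) \<le> 1" for j
  proof (rule ccontr)
    assume "\<not> norm (u j) \<le> 1"
    then have w: "1 < norm (u j)" by simp
    define A where "A = (\<Prod>i\<in>{1..N-1}. norm (u j - b i))"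
    have "(\<Prod>i\<in>UNIV. u j - u i) = 0" by (auto intro: prod_zero)
    then have "u j * (\<Prod>i\<in>{1..N-1}. u j - b i) =
        - ((-1) ^ N * c N * (\<Prod>i\<in>{1..N-1}. 1 - cnj (b i) * u j))"
      using split[of "u j"] by (simp add: add_eq_0_iff2)
    then have "norm (u j * (\<Prod>i\<in>{1..N-1}. u j - b i)) =
        norm ((-1) ^ N * c N * (\<Prod>i\<in>{1..N-1}. 1 - cnj (b i) * u j))"
      by (metis norm_minus_cancel)
    then have "norm (u j) * A = (\<Prod>i\<in>{1..N-1}. norm (1 - cnj (b i) * u j))"
      using cn by (simp add: A_def norm_mult prod_norm[symmetric] norm_power c_def)
    also have "\<dots> \<le> A"
      unfolding A_def by (intro prod_mono) (use w b norm_reflected_factor_le in auto)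
    finally have "norm (u j) * A \<le> A" .
    moreover have "0 < A"
      unfolding A_def by (intro prod_pos) (use w b in fastforce)
    ultimately show False using w by simp
  qed
  have "(\<Prod>i\<in>UNIV. norm (u i)) = 1"
    using cn by (simp add: N elem_sym_card prod_norm)
  then have "1 = norm (u j) * (\<Prod>i\<in>UNIV - {j}. norm (u i))"
    by (simp add: prod.remove[of UNIV j])
  also have "\<dots> \<le> norm (u j) * 1"
    by (intro mult_left_mono prod_le_1) (use le1 in auto)
  finally show ?thesis using le1[of j] by simp
qed

section \<open>Points with prescribed roots in the image of the polydisc\<close>

lemma coord_le: "coord (i :: 'n::{finite,linorder}) \<le> CARD('n)"
  and coord_ge: "1 \<le> coord (i :: 'n::{finite,linorder})"
  using bij_betw_apply[OF bij_coord, of i] by auto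

lemma theta_map_eqI:
  fixes z :: "complex ^ 'n::{finite,linorder}"
  assumes "\<And>i. 1 \<le> i \<Longrightarrow> i < CARD('n) \<Longrightarrow> c i = elem_sym UNIV i (\<lambda>j. (z $ j) ^ m)"
    and "c (CARD('n)) = (\<Prod>j\<in>UNIV. z $ j) ^ (m div p)"
  shows "(\<chi> j. c (coord j)) = theta_map m p z"
proof -
  have "c (coord j) = theta_map m p z $ j" for j :: 'n
    using assms coord_le[of j] coord_ge[of j] by (auto simp: theta_map_def le_less)
  then show ?thesis by (simp add: vec_eq_iff)
qed

lemma theta_map_power_last:
  fixes z :: "complex ^ 'n::{finite,linorder}"
  assumes "p dvd m"
  shows "(theta_map m p z $ Max UNIV) ^ p = (\<Prod>j\<in>UNIV. (z $ j) ^ m)"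
  using assms by (simp add: theta_map_def coord_Max prod_power_distrib flip: power_mult)

text \<open>
  Arbitrary \<open>m\<close>-th roots of the \<open>u\<^sub>j\<close> give the right last coordinate up to a \<open>p\<close>-th root of unity.
  Multiplying one of them by an \<open>m\<close>-th root of unity \<open>\<eta>\<close> corrects this, as \<open>\<eta> ^ (m div p)\<close> runs
  through all \<open>p\<close>-th roots of unity.
\<close>

lemma exists_theta_map_fibre:
  fixes u :: "'n::{finite,linorder} \<Rightarrow> complex"
  assumes "0 < m" "0 < p" "p dvd m" and w: "w ^ p = (\<Prod>j\<in>UNIV. u j)"
  obtains z :: "complex ^ 'n::{finite,linorder}" where "\<And>j. (z $ j) ^ m = u j" "(\<Prod>j\<in>UNIV. z $ j) ^ (m div p) = w"
proof -
  have mp: "0 < m div p" and m: "(m div p) * p = m"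
    using assms by (auto elim!: dvdE)
  have "\<exists>x. x ^ m = u j" for j
    using nth_root_exists[OF \<open>0 < m\<close>, of "u j"] by blast
  then obtain x where x: "\<And>j. x j ^ m = u j" by metis
  define v where "v = (\<Prod>j\<in>UNIV. x j) ^ (m div p)"
  have vp: "v ^ p = w ^ p"
    unfolding w v_def power_mult[symmetric] m by (simp add: x prod_power_distrib)
  obtain \<eta> where \<eta>: "\<eta> ^ (m div p) * v = w" "\<eta> ^ m = 1"
  proof (cases "v = 0")
    case True
    then have "w = 0" using vp \<open>0 < p\<close> by (auto simp: power_0_left)
    then show ?thesis using that[of 1] True by simp
  next
    case False
    obtain \<eta> where e: "\<eta> ^ (m div p) = w / v"
      using nth_root_exists[OF mp, of "w / v"] by blast
    have "\<eta> ^ m = (\<eta> ^ (m div p)) ^ p"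
      by (simp flip: power_mult add: m)
    also have "\<dots> = 1"
      using False vp[symmetric] by (simp add: e power_divide)
    finally show ?thesis using that[of \<eta>] e False by simp
  qed
  define i0 :: 'n where "i0 = Max UNIV"
  define z :: "complex ^ 'n::{finite,linorder}" where "z = (\<chi> j. if j = i0 then \<eta> * x j else x j)"
  have "(z $ j) ^ m = u j" for j
    using \<eta> x by (simp add: z_def power_mult_distrib)
  moreover have "(\<Prod>j\<in>UNIV. z $ j) = \<eta> * (\<Prod>j\<in>UNIV. x j)"
  proof -
    have "(\<Prod>j\<in>UNIV. z $ j) = z $ i0 * (\<Prod>j\<in>UNIV - {i0}. z $ j)"
      by (rule prod.remove) auto
    also have "(\<Prod>j\<in>UNIV - {i0}. z $ j) = (\<Prod>j\<in>UNIV - {i0}. x j)"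
      by (rule prod.cong) (auto simp: z_def)
    also have "z $ i0 * \<dots> = \<eta> * (x i0 * (\<Prod>j\<in>UNIV - {i0}. x j))"
      by (simp add: z_def)
    also have "x i0 * (\<Prod>j\<in>UNIV - {i0}. x j) = (\<Prod>j\<in>UNIV. x j)"
      by (rule prod.remove[symmetric]) auto
    finally show ?thesis .
  qed
  then have "(\<Prod>j\<in>UNIV. z $ j) ^ (m div p) = w"
    using \<eta> by (simp add: power_mult_distrib v_def)
  ultimately show ?thesis by (rule that)
qed

lemma theta_map_of_roots:
  fixes u :: "'n::{finite,linorder} \<Rightarrow> complex"
  assumes "0 < m" "0 < p" "p dvd m"
    and low: "\<And>i. 1 \<le> i \<Longrightarrow> i < CARD('n) \<Longrightarrow> c i = elem_sym UNIV i u"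
    and last: "c (CARD('n)) ^ p = elem_sym UNIV (CARD('n)) u"
  obtains z :: "complex ^ 'n::{finite,linorder}" where "\<And>j. (z $ j) ^ m = u j" "(\<chi> j. c (coord j)) = theta_map m p z"
proof -
  have "c (CARD('n)) ^ p = (\<Prod>j\<in>UNIV. u j)"
    using last by (simp add: elem_sym_card)
  then obtain z :: "complex ^ 'n::{finite,linorder}" where z: "\<And>j. (z $ j) ^ m = u j"
      "(\<Prod>j\<in>UNIV. z $ j) ^ (m div p) = c (CARD('n))"
    using exists_theta_map_fibre[of m p "c (CARD('n))" u] assms by metis
  show ?thesis
    by (rule that[of z]) (use z low in \<open>auto intro!: theta_map_eqI\<close>)
qed

section \<open>Root location propagates from the circle into the disc\<close>

text \<open>
  A maximum principle for the roots of a monic polynomial whose coefficients \<open>c\<^sub>i\<close> depend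
  holomorphically on \<open>z\<close>. The roots themselves are not holomorphic in \<open>z\<close>, but
  \<open>Q\<^sub>z(t) = \<Prod>(1 - t u\<^sub>j)\<close> is, and the claim is that \<open>Q\<^sub>z(t) \<noteq> 0\<close> for \<open>\<bar>t\<bar> < 1\<close>. If \<open>t\<close> is such that
  \<open>Q\<^sub>z(t) \<noteq> 0\<close> for all \<open>z\<close> in the closed disc, then the maximum principle for \<open>1 / Q\<^sub>z(t)\<close> improves
  this to the bound \<open>\<bar>Q\<^sub>z(t)\<bar> \<ge> (1 - \<bar>t\<bar>)\<^sup>N\<close>, which holds on the circle. The nonvanishing is an open
  condition on \<open>t\<close> by compactness, the bound is a closed one, and both hold at \<open>t = 0\<close>;
  connectedness of the disc does the rest.
\<close>

lemma roots_in_disc_of_roots_on_circle: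
  fixes c :: "nat \<Rightarrow> complex \<Rightarrow> complex" and z :: complex
  assumes c0: "\<And>z. c 0 z = 1"
    and cont: "\<And>i. continuous_on (cball 0 1) (c i)"
    and hol: "\<And>i. c i holomorphic_on ball 0 1"
    and circle: "\<And>z. z \<in> sphere 0 1 \<Longrightarrow> \<exists>u :: 'n \<Rightarrow> complex.
        (\<forall>j. norm (u j) \<le> 1) \<and> (\<forall>i\<le>CARD('n::finite). c i z = elem_sym UNIV i u)"
    and z: "z \<in> cball 0 1"
  shows "\<exists>u :: 'n \<Rightarrow> complex.
        (\<forall>j. norm (u j) \<le> 1) \<and> (\<forall>i\<le>CARD('n). c i z = elem_sym UNIV i u)"
proof -
  define N where "N = CARD('n)"
  define Q where "Q z t = (\<Sum>i\<le>N. c i z * (- t) ^ i)" for z t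
  have Q_eq: "Q z t = (\<Prod>j\<in>UNIV. 1 - t * u j)"
    if "\<forall>i\<le>N. c i z = elem_sym UNIV i u" for z t and u :: "'n \<Rightarrow> complex"
    using prod_add_mult_eq_sum_elem_sym[OF finite, of 1 "-t" u] that
    by (simp add: Q_def N_def)
  have on_circle: "(1 - norm t) ^ N \<le> norm (Q z t)" if zt: "z \<in> sphere 0 1" "t \<in> ball 0 1" for z t
  proof -
    obtain u :: "'n \<Rightarrow> complex" where u: "\<forall>j. norm (u j) \<le> 1" "\<forall>i\<le>N. c i z = elem_sym UNIV i u"
      using circle[OF zt(1)] unfolding N_def by blast
    have "(\<Prod>j\<in>(UNIV :: 'n set). 1 - norm t) \<le> (\<Prod>j\<in>UNIV. norm (1 - t * u j))"
    proof (rule prod_mono)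
      fix j
      have "norm (t * u j) \<le> norm t * 1"
        unfolding norm_mult using u(1) by (intro mult_left_mono) auto
      moreover have "1 \<le> norm (1 - t * u j) + norm (t * u j)"
        using norm_triangle_ineq[of "1 - t * u j" "t * u j"] by simp
      ultimately show "0 \<le> 1 - norm t \<and> 1 - norm t \<le> norm (1 - t * u j)"
        using that by simp
    qed
    then show ?thesis
      by (simp add: Q_eq[OF u(2)] prod_norm N_def)
  qed
  have contQ: "continuous_on (cball 0 1) (\<lambda>z. Q z t)" for t
    unfolding Q_def by (intro continuous_intros cont)
  have holQ: "(\<lambda>z. Q z t) holomorphic_on ball 0 1" for t
    unfolding Q_def by (intro holomorphic_intros hol)
  define A where "A = {t \<in> ball 0 1. \<forall>z\<in>cball 0 1. Q z t \<noteq> 0}"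
  have lower: "(1 - norm t) ^ N \<le> norm (Q z t)" if "t \<in> A" "z \<in> cball 0 1" for z t
  proof -
    have nz: "\<forall>z\<in>cball 0 1. Q z t \<noteq> 0" and t: "t \<in> ball 0 1" using that by (auto simp: A_def)
    have "norm (1 / Q z t) \<le> 1 / (1 - norm t) ^ N"
    proof (rule maximum_modulus_frontier[where S = "cball 0 1" and f = "\<lambda>z. 1 / Q z t"])
      show "(\<lambda>z. 1 / Q z t) holomorphic_on interior (cball 0 1)"
        using nz by (auto intro!: holomorphic_intros holQ)
      show "continuous_on (closure (cball 0 1)) (\<lambda>z. 1 / Q z t)"
        using nz by (auto intro!: continuous_intros contQ)
      show "norm (1 / Q y t) \<le> 1 / (1 - norm t) ^ N" if "y \<in> frontier (cball 0 1)" for y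
      proof -
        have "(1 - norm t) ^ N \<le> norm (Q y t)"
          using on_circle[of y t] that t by simp
        moreover have "0 < (1 - norm t) ^ N" using t by simp
        ultimately show ?thesis by (simp add: norm_divide frac_le)
      qed
    qed (use that in auto)
    moreover have "0 < (1 - norm t) ^ N" using t by simp
    moreover have "0 < norm (Q z t)" using nz that by simp
    ultimately show ?thesis by (simp add: norm_divide field_simps)
  qed
  have "A = ball 0 1 \<inter> (\<Inter>z\<in>cball 0 1. {t. (1 - norm t) ^ N \<le> norm (Q z t)})"
  proof (intro subset_antisym subsetI)
    fix t assume "t \<in> ball 0 1 \<inter> (\<Inter>z\<in>cball 0 1. {t. (1 - norm t) ^ N \<le> norm (Q z t)})"
    then have t: "t \<in> ball 0 1" and le: "\<And>z. z \<in> cball 0 1 \<Longrightarrow> (1 - norm t) ^ N \<le> norm (Q z t)"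
      by auto
    have "0 < (1 - norm t) ^ N" using t by simp
    then have "Q z t \<noteq> 0" if "z \<in> cball 0 1" for z using le[OF that] by auto
    then show "t \<in> A" using t by (simp add: A_def)
  qed (use lower in \<open>auto simp: A_def\<close>)
  moreover have "closed (\<Inter>z\<in>cball 0 1. {t. (1 - norm t) ^ N \<le> norm (Q z t)})"
    unfolding Q_def by (intro closed_INT ballI closed_Collect_le continuous_intros)
  ultimately have closed: "closedin (top_of_set (ball 0 1)) A"
    by (metis closedin_closed_Int)
  have "closedin (top_of_set (cball 0 1 \<times> ball 0 1))
      {x \<in> cball 0 1 \<times> ball 0 1. Q (fst x) (snd x) = 0}"
  proof (rule continuous_closedin_preimage_constant)
    have "continuous_on (cball 0 1 \<times> ball 0 1) (\<lambda>x. c i (fst x))" for i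
      by (rule continuous_on_compose2[OF cont]) (auto intro: continuous_intros)
    then show "continuous_on (cball 0 1 \<times> ball 0 1) (\<lambda>x. Q (fst x) (snd x))"
      unfolding Q_def by (intro continuous_intros)
  qed
  \<comment> \<open>The bad \<open>t\<close> form the projection of a closed set along the compact disc of all \<open>z\<close>.\<close>
  from closedin_compact_projection[OF compact_cball this]
  have proj: "closedin (top_of_set (ball 0 1)) {t. \<exists>z. norm z \<le> 1 \<and> norm t < 1 \<and> Q z t = 0}"
    by simp
  have "ball 0 1 - {t. \<exists>z. norm z \<le> 1 \<and> norm t < 1 \<and> Q z t = 0} = A"
    by (auto simp: A_def)
  then have "openin (top_of_set (ball 0 1)) A"
    using openin_diff[OF openin_subtopology_self proj] by simp
  moreover have "0 \<in> A"
  proof -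
    have "Q z 0 = 1" for z
      using c0 unfolding Q_def by (simp add: power_0_left if_distrib sum.delta cong: if_cong)
    then show ?thesis by (simp add: A_def)
  qed
  ultimately have A: "A = ball 0 1"
    using connected_ball[of "0 :: complex" 1] closed unfolding connected_clopen by (metis empty_iff)
  obtain u :: "'n \<Rightarrow> complex" where u: "\<forall>i\<le>N. c i z = elem_sym UNIV i u"
    using exists_elem_sym[of "\<lambda>i. c i z"] c0 unfolding N_def by blast
  have "norm (u j) \<le> 1" for j
  proof (rule ccontr)
    assume "\<not> norm (u j) \<le> 1"
    then have gt: "1 < norm (u j)" by simp
    then have "norm (1 / u j) < 1" by (simp add: norm_divide divide_less_eq)
    then have "1 / u j \<in> A" by (simp add: A)
    then have "Q z (1 / u j) \<noteq> 0" using z by (simp add: A_def)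
    moreover have "1 - 1 / u j * u j = 0" using gt by auto
    then have "(\<Prod>i\<in>UNIV. 1 - 1 / u j * u i) = 0" by (intro prod_zero) auto
    ultimately show False using Q_eq[OF u] by simp
  qed
  then show ?thesis using u unfolding N_def by blast
qed

section \<open>The image of the torus is a closed boundary\<close>

lemma norm_disc_automorphism:
  fixes a w :: complex
  assumes "norm a < 1"
  shows "norm w \<le> 1 \<Longrightarrow> 1 + cnj a * w \<noteq> 0"
    and "norm w = 1 \<Longrightarrow> norm ((w + a) / (1 + cnj a * w)) = 1"
    and "norm w < 1 \<Longrightarrow> norm ((w + a) / (1 + cnj a * w)) < 1"
proof -
  have nz: "1 + cnj a * w \<noteq> 0" if "norm w \<le> 1"
  proof
    assume "1 + cnj a * w = 0"
    then have "cnj a * w = -1" by (metis add_eq_0_iff)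
    then have "norm (cnj a * w) = 1" by simp
    moreover have "norm (cnj a * w) \<le> norm a * 1"
      unfolding norm_mult complex_mod_cnj using that by (intro mult_left_mono) auto
    ultimately show False using assms by simp
  qed
  then show "norm w \<le> 1 \<Longrightarrow> 1 + cnj a * w \<noteq> 0" .
  have eq: "(norm (w + a))\<^sup>2 - (norm (1 + cnj a * w))\<^sup>2 = ((norm w)\<^sup>2 - 1) * (1 - (norm a)\<^sup>2)"
    using norm_diff_reflected_factor[of w "-a"] by simp
  show "norm ((w + a) / (1 + cnj a * w)) = 1" if "norm w = 1"
  proof -
    have "(norm (w + a))\<^sup>2 = (norm (1 + cnj a * w))\<^sup>2" using eq that by simp
    then have "norm (w + a) = norm (1 + cnj a * w)" by (rule power2_eq_imp_eq) auto
    then show ?thesis using nz that by (simp add: norm_divide)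
  qed
  show "norm ((w + a) / (1 + cnj a * w)) < 1" if "norm w < 1"
  proof -
    have "((norm w)\<^sup>2 - 1) * (1 - (norm a)\<^sup>2) < 0"
      using that assms by (intro mult_neg_pos) (auto simp: power_less_one_iff abs_square_less_1)
    then have "(norm (w + a))\<^sup>2 < (norm (1 + cnj a * w))\<^sup>2" using eq by linarith
    then have "norm (w + a) < norm (1 + cnj a * w)" by (rule power_less_imp_less_base) auto
    then show ?thesis using nz that by (simp add: norm_divide divide_less_eq)
  qed
qed

lemma continuous_on_theta_map:
  "continuous_on A (theta_map m p :: complex ^ 'n::{finite,linorder} \<Rightarrow> complex ^ 'n::{finite,linorder})"
proof -
  have "continuous_on A (\<lambda>z :: complex ^ 'n::{finite,linorder}. theta_map m p z $ i)" for i
  proof (cases "coord i < CARD('n)")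
    case True
    then show ?thesis
      by (auto simp: theta_map_def intro!: continuous_elem_sym continuous_intros)
  next
    case False
    then show ?thesis by (auto simp: theta_map_def intro!: continuous_intros)
  qed
  then have "continuous_on A (\<lambda>z :: complex ^ 'n::{finite,linorder}. \<chi> i. theta_map m p z $ i)"
    by (rule continuous_on_vec_lambda)
  then show ?thesis by simp
qed

lemma compact_polydisc: "compact {z :: complex ^ 'n::finite. \<forall>j. z $ j \<in> cball 0 1}"
proof -
  have "closed {z :: complex ^ 'n::finite. \<forall>j. norm (z $ j) \<le> 1}"
    by (intro closed_Collect_all closed_Collect_le continuous_intros)
  moreover have "bounded {z :: complex ^ 'n::finite. \<forall>j. norm (z $ j) \<le> 1}"
  proof (rule boundedI)
    fix z :: "complex ^ 'n::finite" assume "z \<in> {z. \<forall>j. norm (z $ j) \<le> 1}"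
    then have "(\<Sum>j\<in>UNIV. norm (z $ j)) \<le> (\<Sum>j\<in>(UNIV :: 'n set). 1)"
      by (intro sum_mono) auto
    then show "norm z \<le> real CARD('n)"
      using L2_set_le_sum[of UNIV "\<lambda>j. norm (z $ j)"]
      by (simp add: norm_vec_def)
  qed
  ultimately show ?thesis by (simp add: compact_eq_bounded_closed)
qed

lemma compact_torus: "compact {z :: complex ^ 'n::finite. \<forall>j. norm (z $ j) = 1}"
proof -
  have closed: "closed {z :: complex ^ 'n::finite. \<forall>j. norm (z $ j) = 1}"
    by (intro closed_Collect_all closed_Collect_eq continuous_intros)
  have "{z :: complex ^ 'n::finite. \<forall>j. norm (z $ j) = 1} =
      {z. \<forall>j. z $ j \<in> cball 0 1} \<inter> {z. \<forall>j. norm (z $ j) = 1}" by auto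
  then show ?thesis
    using compact_Int_closed[OF compact_polydisc closed] by (simp only:)
qed

lemma holomorphic_vec_on_compose:
  fixes g :: "complex \<Rightarrow> complex ^ 'n::finite"
  assumes f: "holomorphic_vec_on f U"
    and g: "\<And>j. (\<lambda>x. g x $ j) holomorphic_on S" and sub: "g ` S \<subseteq> U"
  shows "(\<lambda>x. f (g x)) holomorphic_on S"
  unfolding holomorphic_on_def field_differentiable_def
proof
  fix x assume x: "x \<in> S"
  have "\<exists>d. ((\<lambda>x. g x $ j) has_field_derivative d) (at x within S)" for j
    using g[of j] x by (auto simp: holomorphic_on_def field_differentiable_def)
  then obtain d where d: "\<And>j. ((\<lambda>x. g x $ j) has_field_derivative d j) (at x within S)"
    by metis
  have g': "(g has_derivative (\<lambda>h. h *s (\<chi> j. d j))) (at x within S)"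
  proof (subst has_derivative_componentwise_within, rule ballI)
    fix b :: "complex ^ 'n::finite" assume "b \<in> Basis"
    then obtain j e where b: "b = axis j e" by (auto simp: Basis_vec_def)
    have "((\<lambda>x. g x $ j) has_derivative (\<lambda>h. h * d j)) (at x within S)"
      using d[of j] by (simp add: has_field_derivative_def mult_commute_abs)
    then have "((\<lambda>x. g x $ j \<bullet> e) has_derivative (\<lambda>h. (h * d j) \<bullet> e)) (at x within S)"
      by (rule has_derivative_inner_left)
    then show "((\<lambda>x. g x \<bullet> b) has_derivative (\<lambda>h. (h *s (\<chi> j. d j)) \<bullet> b)) (at x within S)"
      by (simp add: b inner_axis)
  qed
  from x sub have "g x \<in> U" by auto
  with f obtain f' where f': "(f has_derivative f') (at (g x) within U)"
      and lin: "\<And>c v. f' (c *s v) = c * f' v"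
    unfolding holomorphic_vec_on_def by blast
  have "(f \<circ> g has_derivative f' \<circ> (\<lambda>h. h *s (\<chi> j. d j))) (at x within S)"
    by (rule diff_chain_within[OF g' has_derivative_subset[OF f' sub]])
  moreover have "f' \<circ> (\<lambda>h. h *s (\<chi> j. d j)) = (*) (f' (\<chi> j. d j))"
    by (auto simp: lin)
  ultimately show "\<exists>D. ((\<lambda>x. f (g x)) has_field_derivative D) (at x within S)"
    unfolding has_field_derivative_def o_def by metis
qed

text \<open>
  The maximum principle on the polydisc follows from the one in a single variable: a point \<open>z\<close> of
  the open polydisc is the value at \<open>0\<close> of the analytic disc
  \<open>w \<mapsto> ((w + z\<^sub>j) / (1 + cnj z\<^sub>j w))\<^sub>j\<close>, which maps the unit circle into the torus. Points of the closed
  polydisc are reached by radial limits.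
\<close>

lemma torus_is_closed_boundary:
  "closed_boundary (Theta_open m p) (Theta_closed m p)
     (theta_map m p ` {z :: complex ^ 'n::{finite,linorder}. \<forall>j. norm (z $ j) = 1})"
proof -
  let ?\<theta> = "theta_map m p :: complex ^ 'n::{finite,linorder} \<Rightarrow> complex ^ 'n::{finite,linorder}"
  define T where "T = {z :: complex ^ 'n::{finite,linorder}. \<forall>j. norm (z $ j) = 1}"
  have T: "compact T"
    unfolding T_def by (rule compact_torus)
  have "(\<chi> j. 1) \<in> T" by (simp add: T_def)
  then have neT: "T \<noteq> {}" by blast
  have "closed (?\<theta> ` T)"
    by (intro compact_imp_closed compact_continuous_image continuous_on_theta_map T)
  moreover have "?\<theta> ` T \<subseteq> Theta_closed m p"
    by (auto simp: T_def Theta_closed_def)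
  moreover have "\<exists>x\<in>?\<theta> ` T. \<forall>y\<in>Theta_closed m p. norm (f y) \<le> norm (f x)"
    if cont: "continuous_on (Theta_closed m p) f" and hol: "holomorphic_vec_on f (Theta_open m p)" for f
  proof -
    define P where "P = {z :: complex ^ 'n::{finite,linorder}. \<forall>j. z $ j \<in> cball 0 1}"
    have contP: "continuous_on P (\<lambda>z. f (?\<theta> z))"
      by (rule continuous_on_compose2[OF cont continuous_on_theta_map])
        (auto simp: Theta_closed_def P_def)
    have "continuous_on T (\<lambda>z. norm (f (?\<theta> z)))"
      by (intro continuous_intros continuous_on_subset[OF contP]) (auto simp: T_def P_def)
    then obtain x where x: "x \<in> T" and max: "\<And>z. z \<in> T \<Longrightarrow> norm (f (?\<theta> z)) \<le> norm (f (?\<theta> x))"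
      using continuous_attains_sup[OF T neT] by blast
    have inner: "norm (f (?\<theta> z)) \<le> norm (f (?\<theta> x))" if z: "\<And>j. norm (z $ j) < 1" for z
    proof -
      define b where "b w = (\<chi> j. (w + z $ j) / (1 + cnj (z $ j) * w))" for w
      have b_in: "w \<in> ball 0 1 \<Longrightarrow> ?\<theta> (b w) \<in> Theta_open m p" for w
        unfolding Theta_open_def b_def
        using norm_disc_automorphism(3)[OF z] by (auto intro!: imageI)
      have b_T: "norm w = 1 \<Longrightarrow> b w \<in> T" for w
        using norm_disc_automorphism(2)[OF z] by (auto simp: b_def T_def)
      have b_P: "w \<in> cball 0 1 \<Longrightarrow> b w \<in> P" for w
        using norm_disc_automorphism(2,3)[OF z, of w] 
        by (cases "norm w = 1") (auto simp: b_def P_def less_imp_le)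
      have hol_b: "(\<lambda>w. b w $ j) holomorphic_on ball 0 1" for j
        unfolding b_def using norm_disc_automorphism(1)[OF z]
        by (auto intro!: holomorphic_intros)
      have cont_b: "continuous_on (cball 0 1) b"
        unfolding b_def using norm_disc_automorphism(1)[OF z]
        by (auto intro!: continuous_intros)
      have "norm (f (?\<theta> (b 0))) \<le> norm (f (?\<theta> x))"
      proof (rule maximum_modulus_frontier[where S = "cball 0 1" and f = "\<lambda>w. f (?\<theta> (b w))"])
        have "(\<lambda>w. ?\<theta> (b w) $ j) holomorphic_on ball 0 1" for j
          unfolding theta_map_def elem_sym_def
          by (cases "coord j < CARD('n)") (auto intro!: holomorphic_intros hol_b)
        then show "(\<lambda>w. f (?\<theta> (b w))) holomorphic_on interior (cball 0 1)"
          using holomorphic_vec_on_compose[OF hol, of "\<lambda>w. ?\<theta> (b w)" "ball 0 1"] b_in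
          by (simp add: image_subset_iff)
        show "continuous_on (closure (cball 0 1)) (\<lambda>w. f (?\<theta> (b w)))"
          using continuous_on_compose2[OF contP cont_b] b_P by (simp add: image_subset_iff)
        show "norm (f (?\<theta> (b w))) \<le> norm (f (?\<theta> x))" if "w \<in> frontier (cball 0 1)" for w
          using that by (intro max b_T) simp
      qed auto
      moreover have "b 0 = z" by (simp add: b_def vec_eq_iff)
      ultimately show ?thesis by simp
    qed
    have "norm (f (?\<theta> z)) \<le> norm (f (?\<theta> x))" if z: "z \<in> P" for z
    proof -
      define s where "s r = (\<chi> j. complex_of_real r * z $ j)" for r
      have "norm (f (?\<theta> (s 1))) \<le> norm (f (?\<theta> x))"
      proof (rule continuous_le_on_closure[where S = "{0<..<1}" and f = "\<lambda>r. norm (f (?\<theta> (s r)))"])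
        have "s r \<in> P" if "r \<in> {0..1}" for r
          using that z by (auto simp: P_def s_def norm_mult intro!: mult_le_one)
        moreover have "continuous_on {0..1} s"
          unfolding s_def by (intro continuous_intros)
        ultimately have "continuous_on {0..1} (\<lambda>r. f (?\<theta> (s r)))"
          by (intro continuous_on_compose2[OF contP]) auto
        then show "continuous_on (closure {0<..<1}) (\<lambda>r. norm (f (?\<theta> (s r))))"
          by (simp add: continuous_on_norm)
        show "norm (f (?\<theta> (s r))) \<le> norm (f (?\<theta> x))" if r: "r \<in> {0<..<1}" for r
        proof (rule inner)
          fix j
          have "norm (s r $ j) \<le> r * 1"
            unfolding s_def using r z by (auto simp: norm_mult P_def intro!: mult_left_mono)
          then show "norm (s r $ j) < 1" using r by simp
        qed
      qed auto
      moreover have "s 1 = z" by (simp add: s_def vec_eq_iff)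
      ultimately show ?thesis by simp
    qed
    then have "\<forall>y\<in>Theta_closed m p. norm (f y) \<le> norm (f (?\<theta> x))"
      unfolding Theta_closed_def P_def by blast
    then show ?thesis using x by blast
  qed
  ultimately show ?thesis unfolding closed_boundary_def T_def by blast
qed

section \<open>Every closed boundary contains the image of the torus\<close>

abbreviation holomorphic_everywhere :: "(complex ^ 'n::finite \<Rightarrow> complex) \<Rightarrow> bool"
  where "holomorphic_everywhere f \<equiv> holomorphic_vec_on f UNIV"

lemma holomorphic_everywhereE:
  assumes "holomorphic_everywhere f"
  obtains f' where "(f has_derivative f') (at x)" "\<And>c v. f' (c *s v) = c * f' v"
proof -
  have "\<exists>f'. (f has_derivative f') (at x) \<and> (\<forall>c v. f' (c *s v) = c * f' v)"
    using assms unfolding holomorphic_vec_on_def by simp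
  then show ?thesis using that by blast
qed

lemma holomorphic_everywhere_imp:
  assumes "holomorphic_everywhere f"
  shows "holomorphic_vec_on f U" "continuous_on K f"
proof -
  show "holomorphic_vec_on f U"
    unfolding holomorphic_vec_on_def
    using assms by (metis has_derivative_at_withinI holomorphic_everywhereE)
  have "isCont f x" for x
    using assms by (metis has_derivative_continuous holomorphic_everywhereE)
  then show "continuous_on K f"
    by (simp add: continuous_at_imp_continuous_on)
qed

lemma holomorphic_everywhere_const: "holomorphic_everywhere (\<lambda>x. c)"
  unfolding holomorphic_vec_on_def by (auto intro!: exI[of _ "\<lambda>_. 0"])

lemma holomorphic_everywhere_nth: "holomorphic_everywhere (\<lambda>x. x $ i)"
  unfolding holomorphic_vec_on_def
  by (auto intro!: exI[of _ "\<lambda>x. x $ i"] bounded_linear_imp_has_derivative bounded_linear_vec_nth)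

lemma holomorphic_everywhere_add:
  assumes "holomorphic_everywhere f" "holomorphic_everywhere g"
  shows "holomorphic_everywhere (\<lambda>x. f x + g x)"
  unfolding holomorphic_vec_on_def
proof
  fix x
  obtain f' where f': "(f has_derivative f') (at x)" "\<And>c v. f' (c *s v) = c * f' v"
    using holomorphic_everywhereE[OF assms(1), of x] by blast
  obtain g' where g': "(g has_derivative g') (at x)" "\<And>c v. g' (c *s v) = c * g' v"
    using holomorphic_everywhereE[OF assms(2), of x] by blast
  show "\<exists>h'. ((\<lambda>x. f x + g x) has_derivative h') (at x) \<and> (\<forall>c v. h' (c *s v) = c * h' v)"
    using has_derivative_add[OF f'(1) g'(1)] f'(2) g'(2)
    by (intro exI[of _ "\<lambda>v. f' v + g' v"]) (simp add: algebra_simps)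
qed

lemma holomorphic_everywhere_mult:
  assumes "holomorphic_everywhere f" "holomorphic_everywhere g"
  shows "holomorphic_everywhere (\<lambda>x. f x * g x)"
  unfolding holomorphic_vec_on_def
proof
  fix x
  obtain f' where f': "(f has_derivative f') (at x)" "\<And>c v. f' (c *s v) = c * f' v"
    using holomorphic_everywhereE[OF assms(1), of x] by blast
  obtain g' where g': "(g has_derivative g') (at x)" "\<And>c v. g' (c *s v) = c * g' v"
    using holomorphic_everywhereE[OF assms(2), of x] by blast
  show "\<exists>h'. ((\<lambda>x. f x * g x) has_derivative h') (at x) \<and> (\<forall>c v. h' (c *s v) = c * h' v)"
    using has_derivative_mult[OF f'(1) g'(1)] f'(2) g'(2)
    by (intro exI[of _ "\<lambda>v. f x * g' v + f' v * g x"]) (simp add: algebra_simps)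
qed

lemma holomorphic_everywhere_power:
  "holomorphic_everywhere f \<Longrightarrow> holomorphic_everywhere (\<lambda>x. f x ^ k)"
  by (induction k) (auto intro: holomorphic_everywhere_const holomorphic_everywhere_mult)

lemma holomorphic_everywhere_sum:
  "(\<And>i. i \<in> I \<Longrightarrow> holomorphic_everywhere (f i)) \<Longrightarrow> holomorphic_everywhere (\<lambda>x. \<Sum>i\<in>I. f i x)"
  by (induction I rule: infinite_finite_induct)
    (auto intro: holomorphic_everywhere_const holomorphic_everywhere_add)

text \<open>
  In terms of \<open>u\<^sub>j = z\<^sub>j\<^sup>m\<close>, all coordinates of \<open>theta_map m p z\<close> but the last are elementary symmetric
  functions of \<open>u\<close>, and the \<open>p\<close>-th power of the last is the product of the \<open>u\<^sub>j\<close>.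
\<close>

lemma elem_sym_factors_through_theta_map:
  assumes "p dvd m" "i \<le> CARD('n)"
  shows "\<exists>f. holomorphic_everywhere f \<and>
    (\<forall>z :: complex ^ 'n::{finite,linorder}. f (theta_map m p z) = elem_sym UNIV i (\<lambda>j. (z $ j) ^ m))"
proof -
  consider "i = 0" | "1 \<le> i" "i < CARD('n)" | "i = CARD('n)" using assms(2) by linarith
  then show ?thesis
  proof cases
    case 1
    then show ?thesis
      by (intro exI[of _ "\<lambda>_. 1"]) (simp add: holomorphic_everywhere_const)
  next
    case 2
    then have "i \<in> coord ` (UNIV :: 'n set)"
      using bij_betw_imp_surj_on[OF bij_coord[where 'n = 'n]] by simp
    then obtain j :: 'n where "i = coord j" by blast
    with 2 show ?thesis
      by (intro exI[of _ "\<lambda>x. x $ j"]) (simp add: holomorphic_everywhere_nth theta_map_def)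
  next
    case 3
    then show ?thesis
      by (intro exI[of _ "\<lambda>x. (x $ Max UNIV) ^ p"])
        (simp add: holomorphic_everywhere_nth holomorphic_everywhere_power
          theta_map_power_last[OF assms(1)] elem_sym_card)
  qed
qed

text \<open>
  Factor \<open>q\<close> into linear factors: \<open>\<Prod>(u\<^sub>j - a)\<close> is a linear combination of elementary symmetric functions.
\<close>

lemma prod_poly_factors_through_theta_map:
  assumes "p dvd m"
  shows "\<exists>f. holomorphic_everywhere f \<and>
    (\<forall>z :: complex ^ 'n::{finite,linorder}. f (theta_map m p z) = (\<Prod>j\<in>UNIV. poly q ((z $ j) ^ m)))"
proof -
  have lin: "\<exists>f. holomorphic_everywhere f \<and>
    (\<forall>z :: complex ^ 'n::{finite,linorder}. f (theta_map m p z) = (\<Prod>j\<in>UNIV. (z $ j) ^ m - a))" for a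
  proof -
    have "\<forall>i\<in>{..CARD('n)}. \<exists>f. holomorphic_everywhere f \<and>
      (\<forall>z :: complex ^ 'n::{finite,linorder}. f (theta_map m p z) = elem_sym UNIV i (\<lambda>j. (z $ j) ^ m))"
      using elem_sym_factors_through_theta_map[OF assms] by auto
    from bchoice[OF this] obtain f where f: "\<And>i. i \<le> CARD('n) \<Longrightarrow> holomorphic_everywhere (f i)"
      "\<And>i (z :: complex ^ 'n::{finite,linorder}). i \<le> CARD('n) \<Longrightarrow>
         f i (theta_map m p z) = elem_sym UNIV i (\<lambda>j. (z $ j) ^ m)"
      by auto
    show ?thesis
    proof (intro exI conjI allI)
      show "holomorphic_everywhere (\<lambda>x. \<Sum>i\<le>CARD('n). f i x * (- a) ^ (CARD('n) - i))"
        by (intro holomorphic_everywhere_sum holomorphic_everywhere_mult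
            holomorphic_everywhere_const f) simp
      show "(\<Sum>i\<le>CARD('n). f i (theta_map m p z) * (- a) ^ (CARD('n) - i)) =
          (\<Prod>j\<in>UNIV. (z $ j) ^ m - a)" for z :: "complex ^ 'n::{finite,linorder}"
        using prod_add_mult_eq_sum_elem_sym[OF finite, of "-a" 1 "\<lambda>j. (z $ j) ^ m"]
        by (simp add: f)
    qed
  qed
  have prods: "\<exists>f. holomorphic_everywhere f \<and> (\<forall>z :: complex ^ 'n::{finite,linorder}.
      f (theta_map m p z) = (\<Prod>j\<in>UNIV. poly (\<Prod>a\<in>#A. [:- a, 1:]) ((z $ j) ^ m)))" for A
  proof (induction A)
    case empty
    show ?case by (intro exI[of _ "\<lambda>_. 1"]) (simp add: holomorphic_everywhere_const)
  next
    case (add a A)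
    obtain g where g: "holomorphic_everywhere g" "\<And>z :: complex ^ 'n::{finite,linorder}.
      g (theta_map m p z) = (\<Prod>j\<in>UNIV. poly (\<Prod>a\<in>#A. [:- a, 1:]) ((z $ j) ^ m))"
      using add.IH by blast
    obtain f where f: "holomorphic_everywhere f" "\<And>z :: complex ^ 'n::{finite,linorder}.
      f (theta_map m p z) = (\<Prod>j\<in>UNIV. (z $ j) ^ m - a)"
      using lin[of a] by blast
    show ?case
      by (intro exI[of _ "\<lambda>x. f x * g x"] conjI holomorphic_everywhere_mult f(1) g(1))
        (simp add: f g algebra_simps flip: prod.distrib)
  qed
  show ?thesis
  proof (cases "q = 0")
    case True
    then show ?thesis by (intro exI[of _ "\<lambda>_. 0"]) (simp add: holomorphic_everywhere_const)
  next
    case False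
    then obtain A where A: "q = smult (lead_coeff q) (\<Prod>a\<in>#A. [:- a, 1:])"
      using alg_closed_imp_factorization by blast
    obtain f where f: "holomorphic_everywhere f" "\<And>z :: complex ^ 'n::{finite,linorder}.
      f (theta_map m p z) = (\<Prod>j\<in>UNIV. poly (\<Prod>a\<in>#A. [:- a, 1:]) ((z $ j) ^ m))"
      using prods[of A] by blast
    have "poly q x = lead_coeff q * poly (\<Prod>a\<in>#A. [:- a, 1:]) x" for x
      by (subst A) (rule poly_smult)
    then show ?thesis
      by (intro exI[of _ "\<lambda>x. lead_coeff q ^ CARD('n) * f x"] conjI holomorphic_everywhere_mult
          holomorphic_everywhere_const f(1)) (simp add: f prod.distrib)
  qed
qed

text \<open>
  Ryser's formula for the permanent, by inclusion and exclusion over the set of values of \<open>\<phi>\<close>.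
  It writes a symmetrized product \<open>\<Sum>\<^sub>\<phi> \<Prod>\<^sub>j q\<^sub>\<phi>\<^sub>(\<^sub>j\<^sub>)(u\<^sub>j)\<close> as a combination of products \<open>\<Prod>\<^sub>j q(u\<^sub>j)\<close>
  with the same \<open>q\<close> for all \<open>j\<close>, and such products are functions of the elementary symmetric ones;
  this replaces the fundamental theorem on symmetric polynomials.
\<close>

lemma permanent_eq_sum_prod_sum:
  fixes q :: "'n::finite \<Rightarrow> 'n \<Rightarrow> complex"
  shows "(\<Sum>\<phi> | surj \<phi>. \<Prod>j\<in>UNIV. q (\<phi> j) j) =
    (\<Sum>T\<in>UNIV. (-1) ^ card (- T) * (\<Prod>j\<in>UNIV. \<Sum>i\<in>T. q i j))"
proof -
  have sign: "(\<Sum>T\<in>UNIV. if range \<phi> \<subseteq> T then (-1) ^ card (- T) else 0) =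
      (if surj \<phi> then 1 else 0 :: complex)" for \<phi> :: "'n \<Rightarrow> 'n"
  proof -
    have "(\<Prod>i\<in>UNIV. 1 + (if i \<in> range \<phi> then 0 else -1 :: complex)) =
        (\<Sum>T\<in>Pow UNIV. (\<Prod>i\<in>T. 1) * (\<Prod>i\<in>UNIV - T. if i \<in> range \<phi> then 0 else -1))"
      by (rule prod_add) simp
    also have "\<dots> = (\<Sum>T\<in>UNIV. if range \<phi> \<subseteq> T then (-1) ^ card (- T) else 0)"
    proof (intro sum.cong)
      fix T :: "'n set"
      have "(\<Prod>i\<in>- T. if i \<in> range \<phi> then 0 else -1) =
          (if range \<phi> \<subseteq> T then (-1) ^ card (- T) else 0 :: complex)"
      proof (cases "range \<phi> \<subseteq> T")
        case True
        then have "(\<Prod>i\<in>- T. if i \<in> range \<phi> then 0 else -1 :: complex) = (\<Prod>i\<in>- T. -1)"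
          by (intro prod.cong) auto
        then show ?thesis using True by simp
      next
        case False
        then obtain i where "i \<in> - T" "i \<in> range \<phi>" by blast
        then have "(\<Prod>i\<in>- T. if i \<in> range \<phi> then 0 else -1 :: complex) = 0"
          by (intro prod_zero) auto
        then show ?thesis using False by simp
      qed
      then show "(\<Prod>i\<in>T. 1) * (\<Prod>i\<in>UNIV - T. if i \<in> range \<phi> then 0 else -1) =
          (if range \<phi> \<subseteq> T then (-1) ^ card (- T) else 0 :: complex)"
        by (simp add: Compl_eq_Diff_UNIV)
    qed simp
    also have "(\<Prod>i\<in>UNIV. 1 + (if i \<in> range \<phi> then 0 else -1 :: complex)) = (if surj \<phi> then 1 else 0)"
    proof (cases "surj \<phi>")
      case False
      then obtain i where "i \<notin> range \<phi>" by blast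
      then have "(\<Prod>i\<in>UNIV. 1 + (if i \<in> range \<phi> then 0 else -1 :: complex)) = 0"
        by (intro prod_zero) auto
      then show ?thesis using False by simp
    qed simp
    finally show ?thesis ..
  qed
  have "(\<Sum>T\<in>UNIV. (-1) ^ card (- T) * (\<Prod>j\<in>UNIV. \<Sum>i\<in>T. q i j)) =
      (\<Sum>T\<in>UNIV. \<Sum>\<phi>\<in>UNIV. (if range \<phi> \<subseteq> T then (-1) ^ card (- T) else 0) * (\<Prod>j\<in>UNIV. q (\<phi> j) j))"
  proof (intro sum.cong refl)
    fix T :: "'n set"
    have PiE: "UNIV \<rightarrow>\<^sub>E T = {\<phi> :: 'n \<Rightarrow> 'n. range \<phi> \<subseteq> T}" by auto
    have "(\<Prod>j\<in>UNIV. \<Sum>i\<in>T. q i j) = (\<Sum>\<phi> | range \<phi> \<subseteq> T. \<Prod>j\<in>UNIV. q (\<phi> j) j)"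
      using prod_sum_PiE[of "UNIV :: 'n set" "\<lambda>_. T" "\<lambda>j i. q i j"] by (simp add: PiE)
    also have "\<dots> = (\<Sum>\<phi>\<in>UNIV. if range \<phi> \<subseteq> T then \<Prod>j\<in>UNIV. q (\<phi> j) j else 0)"
      by (simp add: sum.If_cases)
    finally show "(-1) ^ card (- T) * (\<Prod>j\<in>UNIV. \<Sum>i\<in>T. q i j) =
        (\<Sum>\<phi>\<in>UNIV. (if range \<phi> \<subseteq> T then (-1) ^ card (- T) else 0) * (\<Prod>j\<in>UNIV. q (\<phi> j) j))"
      by (auto simp: sum_distrib_left intro!: sum.cong)
  qed
  also have "\<dots> = (\<Sum>\<phi>\<in>UNIV. (if surj \<phi> then 1 else 0) * (\<Prod>j\<in>UNIV. q (\<phi> j) j))"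
    by (subst sum.swap) (simp add: sum_distrib_right[symmetric] sign)
  also have "\<dots> = (\<Sum>\<phi> | surj \<phi>. \<Prod>j\<in>UNIV. q (\<phi> j) j)"
    by (simp add: sum.If_cases if_distrib[of "\<lambda>x. x * _"] cong: if_cong)
  finally show ?thesis ..
qed

definition peak :: "complex \<Rightarrow> complex"
  where "peak v = (1 + v) / 2"

lemma peak_1 [simp]: "peak 1 = 1"
  by (simp add: peak_def)

lemma norm_peak_le: "norm v \<le> 1 \<Longrightarrow> norm (peak v) \<le> 1"
  using norm_triangle_ineq[of 1 v] by (simp add: peak_def norm_divide)

lemma norm_peak_eq_1D:
  assumes "norm v \<le> 1" "norm (peak v) = 1"
  shows "v = 1"
proof -
  have "(norm (1 + v))\<^sup>2 = 4" using assms(2) by (simp add: peak_def norm_divide)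
  then have "(1 + Re v)\<^sup>2 + (Im v)\<^sup>2 = 4" by (simp add: cmod_power2)
  moreover have "(Re v)\<^sup>2 + (Im v)\<^sup>2 \<le> 1"
    using assms(1) by (simp add: cmod_power2[symmetric] power_le_one)
  moreover have "Re v \<le> 1" using assms(1) complex_Re_le_cmod[of v] by linarith
  ultimately have "Re v = 1" by (simp add: power2_eq_square algebra_simps)
  moreover from this \<open>(Re v)\<^sup>2 + (Im v)\<^sup>2 \<le> 1\<close> have "Im v = 0" by simp
  ultimately show ?thesis by (simp add: complex_eq_iff)
qed

lemma norm_mult_eq_1D:
  fixes x y :: complex
  assumes "norm x \<le> 1" "norm y \<le> 1" "norm (x * y) = 1"
  shows "norm x = 1" "norm y = 1"
proof -
  have "1 \<le> norm x" using assms mult_left_le[of "norm y" "norm x"] by (simp add: norm_mult)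
  then show "norm x = 1" using assms by simp
  then show "norm y = 1" using assms by (simp add: norm_mult)
qed

lemma norm_prod_peak:
  assumes "finite J" "\<And>j. j \<in> J \<Longrightarrow> norm (v j) \<le> 1"
  shows "norm (\<Prod>j\<in>J. peak (v j)) \<le> 1"
    and "norm (\<Prod>j\<in>J. peak (v j)) = 1 \<Longrightarrow> \<forall>j\<in>J. v j = 1"
proof -
  have *: "norm (\<Prod>j\<in>J. peak (v j)) \<le> 1 \<and> (norm (\<Prod>j\<in>J. peak (v j)) = 1 \<longrightarrow> (\<forall>j\<in>J. v j = 1))"
    using assms
  proof (induction J)
    case (insert j J)
    have vj: "norm (v j) \<le> 1" by (rule insert.prems) simp
    have IH: "norm (\<Prod>j\<in>J. peak (v j)) \<le> 1 \<and>
        (norm (\<Prod>j\<in>J. peak (v j)) = 1 \<longrightarrow> (\<forall>j\<in>J. v j = 1))"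
      by (rule insert.IH, rule insert.prems) simp
    note le = norm_peak_le[OF vj] conjunct1[OF IH]
    have eq: "(\<Prod>j\<in>insert j J. peak (v j)) = peak (v j) * (\<Prod>j\<in>J. peak (v j))"
      using insert.hyps by simp
    have "norm (\<Prod>j\<in>insert j J. peak (v j)) \<le> 1"
      unfolding eq norm_mult using le by (intro mult_le_one) simp_all
    moreover have "\<forall>i\<in>insert j J. v i = 1" if "norm (\<Prod>j\<in>insert j J. peak (v j)) = 1"
    proof -
      note j = norm_mult_eq_1D(1)[OF le that[unfolded eq]]
        and J = norm_mult_eq_1D(2)[OF le that[unfolded eq]]
      have "v j = 1"
        by (rule norm_peak_eq_1D[OF vj j])
      moreover have "\<forall>i\<in>J. v i = 1"
        by (rule mp[OF conjunct2[OF IH] J])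
      ultimately show ?thesis by blast
    qed
    ultimately show ?case by blast
  qed simp
  show "norm (\<Prod>j\<in>J. peak (v j)) \<le> 1"
    by (rule conjunct1[OF *])
  show "norm (\<Prod>j\<in>J. peak (v j)) = 1 \<Longrightarrow> \<forall>j\<in>J. v j = 1"
    by (rule mp[OF conjunct2[OF *]])
qed

lemma cnj_mult_eq_1D: "norm (a :: complex) = 1 \<Longrightarrow> cnj a * x = 1 \<Longrightarrow> x = a"
  by (metis complex_norm_square mult.assoc mult.commute mult_1 of_real_1 one_power2)

lemma uniform_bound_on_compact:
  fixes g :: "'i::finite \<Rightarrow> 'a::topological_space \<Rightarrow> complex"
  assumes "compact K" "\<And>i. continuous_on K (g i)" "\<And>i x. i \<in> I \<Longrightarrow> x \<in> K \<Longrightarrow> norm (g i x) < 1"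
  shows "\<exists>\<rho>. 0 \<le> \<rho> \<and> \<rho> < 1 \<and> (\<forall>i\<in>I. \<forall>x\<in>K. norm (g i x) \<le> \<rho>)"
proof -
  have "\<exists>r. 0 \<le> r \<and> r < 1 \<and> (\<forall>x\<in>K. i \<in> I \<longrightarrow> norm (g i x) \<le> r)" for i
  proof (cases "K = {} \<or> i \<notin> I")
    case False
    have "continuous_on K (\<lambda>x. norm (g i x))" by (intro continuous_on_norm assms)
    then obtain y where "y \<in> K" "\<forall>x\<in>K. norm (g i x) \<le> norm (g i y)"
      using continuous_attains_sup[OF assms(1)] False by blast
    then show ?thesis using False assms(3) by (intro exI[of _ "norm (g i y)"]) auto
  qed (auto intro: exI[of _ 0])
  then obtain r where r: "\<And>i. 0 \<le> r i \<and> r i < 1 \<and> (\<forall>x\<in>K. i \<in> I \<longrightarrow> norm (g i x) \<le> r i)"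
    by metis
  have le: "r i \<le> Max (range r)" for i by simp
  show ?thesis
  proof (intro exI conjI ballI)
    show "0 \<le> Max (range r)" using r le order_trans by blast
    show "Max (range r) < 1" using r by (subst Max_less_iff) auto
    show "norm (g i x) \<le> Max (range r)" if "i \<in> I" "x \<in> K" for i x
      using r[of i] that le[of i] order_trans by blast
  qed
qed

lemma norm_theta_map_last_le:
  fixes z :: "complex ^ 'n::{finite,linorder}"
  assumes "\<And>j. norm (z $ j) \<le> 1"
  shows "norm (theta_map m p z $ Max UNIV) \<le> 1"
  using assms by (auto simp: theta_map_def coord_Max norm_power prod_norm[symmetric]
      intro!: power_le_one prod_nonneg prod_le_1)

lemma norm_theta_map_last_eq_1:
  fixes z :: "complex ^ 'n::{finite,linorder}"
  assumes "\<And>j. norm (z $ j) = 1"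
  shows "norm (theta_map m p z $ Max UNIV) = 1"
  using assms by (simp add: theta_map_def coord_Max norm_power prod_norm[symmetric])

lemma theta_map_eq_of_permuted_powers:
  fixes z \<zeta> :: "complex ^ 'n::{finite,linorder}"
  assumes "surj \<phi>" "\<And>j. (z $ j) ^ m = (\<zeta> $ \<phi> j) ^ m"
    and "theta_map m p z $ Max UNIV = theta_map m p \<zeta> $ Max UNIV"
  shows "theta_map m p z = theta_map m p \<zeta>"
proof -
  have bij: "bij_betw \<phi> UNIV UNIV"
    using assms(1) finite_UNIV_surj_inj[OF finite assms(1)] by (simp add: bij_betw_def)
  have "theta_map m p z $ i = theta_map m p \<zeta> $ i" for i
  proof (cases "coord i < CARD('n)")
    case True
    have "elem_sym UNIV (coord i) (\<lambda>j. (z $ j) ^ m) = elem_sym UNIV (coord i) ((\<lambda>j. (\<zeta> $ j) ^ m) \<circ> \<phi>)"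
      by (simp add: assms(2) o_def)
    also have "\<dots> = elem_sym UNIV (coord i) (\<lambda>j. (\<zeta> $ j) ^ m)"
      by (rule elem_sym_permute) (fact bij)
    finally show ?thesis using True by (simp add: theta_map_def)
  next
    case False
    then have "coord i = coord (Max UNIV :: 'n)"
      using coord_le[of i] by (simp add: coord_Max)
    then have "i = Max UNIV" by (rule injD[OF inj_coord])
    then show ?thesis using assms(3) by simp
  qed
  then show ?thesis by (simp add: vec_eq_iff)
qed

text \<open>
  Suppose that \<open>S\<close> misses \<open>\<theta>(\<zeta>)\<close>. For a permutation \<open>\<phi>\<close> let \<open>t\<^sub>\<phi>\<close> be the product of peak functions that
  has modulus \<open>1\<close> exactly where \<open>z\<^sub>j\<^sup>m = \<zeta>\<^sub>\<phi>\<^sub>(\<^sub>j\<^sub>)\<^sup>m\<close> for all \<open>j\<close> and the last coordinate agrees with that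
  of \<open>\<theta>(\<zeta>)\<close>; at such points \<open>\<theta>(z) = \<theta>(\<zeta>)\<close>. By compactness \<open>\<bar>t\<^sub>\<phi>\<bar> \<le> \<rho> < 1\<close> over \<open>S\<close>. The symmetric sum
  \<open>F\<^sub>N = \<Sum>\<^sub>\<phi> t\<^sub>\<phi>\<^sup>N\<close> is a polynomial in the coordinates, so \<open>\<bar>F\<^sub>N(\<zeta>)\<bar>\<close> is at
  most its maximum over \<open>S\<close>, and tends to \<open>0\<close>. But \<open>t\<^sub>\<phi>(\<zeta>)\<close> is either \<open>1\<close> or of modulus less than \<open>1\<close>, so \<open>F\<^sub>N(\<zeta>)\<close> tends to the
  number of \<open>\<phi>\<close> with \<open>t\<^sub>\<phi>(\<zeta>) = 1\<close>, and the identity is one of them.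
\<close>

lemma torus_subset_closed_boundary:
  fixes \<zeta> :: "complex ^ 'n::{finite,linorder}"
  assumes "p dvd m" and bd: "closed_boundary (Theta_open m p) (Theta_closed m p) S"
    and \<zeta>: "\<And>j. norm (\<zeta> $ j) = 1"
  shows "theta_map m p \<zeta> \<in> S"
proof (rule ccontr)
  assume notin: "theta_map m p \<zeta> \<notin> S"
  define a where "a j = (\<zeta> $ j) ^ m" for j
  define w0 where "w0 = theta_map m p \<zeta> $ Max UNIV"
  have a1: "norm (a j) = 1" for j by (simp add: a_def norm_power \<zeta>)
  have w01: "norm w0 = 1" unfolding w0_def by (rule norm_theta_map_last_eq_1) (rule \<zeta>)
  define P where "P = {z :: complex ^ 'n::{finite,linorder}. \<forall>j. z $ j \<in> cball 0 1}"
  define t where "t \<phi> z = (\<Prod>j\<in>UNIV. peak (cnj (a (\<phi> j)) * (z $ j) ^ m)) *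
      peak (cnj w0 * theta_map m p z $ Max UNIV)" for \<phi> :: "'n \<Rightarrow> 'n" and z
  define F where "F N z = (\<Sum>\<phi> | surj \<phi>. t \<phi> z ^ N)" for N z
  have inP: "norm (z $ j) \<le> 1" if "z \<in> P" for z j using that by (auto simp: P_def)
  have v1: "norm (cnj (a i) * (z $ j) ^ m) \<le> 1" if "z \<in> P" for z i j
    using inP[OF that] by (simp add: norm_mult a1 norm_power power_le_one)
  have v2: "norm (cnj w0 * theta_map m p z $ Max UNIV) \<le> 1" if "z \<in> P" for z
    using norm_theta_map_last_le[of z m p] inP[OF that] by (simp add: norm_mult w01)
  have t_le: "norm (t \<phi> z) \<le> 1" if "z \<in> P" for \<phi> z
    unfolding t_def norm_mult
    by (intro mult_le_one norm_prod_peak norm_peak_le v1 v2 that) simp_all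
  have t_eq_1: "(\<forall>j. (z $ j) ^ m = a (\<phi> j)) \<and> theta_map m p z $ Max UNIV = w0"
    if z: "z \<in> P" and t1: "norm (t \<phi> z) = 1" for \<phi> z
  proof -
    have le1: "norm (\<Prod>j\<in>UNIV. peak (cnj (a (\<phi> j)) * (z $ j) ^ m)) \<le> 1"
      by (intro norm_prod_peak v1 z) simp
    have le2: "norm (peak (cnj w0 * theta_map m p z $ Max UNIV)) \<le> 1"
      by (intro norm_peak_le v2 z)
    note eqs = norm_mult_eq_1D[OF le1 le2 t1[unfolded t_def]]
    have "\<forall>j\<in>UNIV. cnj (a (\<phi> j)) * (z $ j) ^ m = 1"
      by (rule norm_prod_peak(2)[OF _ _ eqs(1)]) (auto intro: v1 z)
    then have "(z $ j) ^ m = a (\<phi> j)" for j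
      using cnj_mult_eq_1D[OF a1] by simp
    moreover have "theta_map m p z $ Max UNIV = w0"
      by (rule cnj_mult_eq_1D[OF w01 norm_peak_eq_1D[OF v2[OF z] eqs(2)]])
    ultimately show ?thesis by simp
  qed

  have F_factors: "\<exists>f. holomorphic_everywhere f \<and>
      (\<forall>z :: complex ^ 'n::{finite,linorder}. f (theta_map m p z) = F N z)" for N
  proof -
    \<comment> \<open>As \<open>t\<^sub>\<phi>\<^sup>N\<close> is a product of polynomials in the single \<open>u\<^sub>j\<close>, Ryser's formula applies.\<close>
    define q where "q i = [:1 / 2, cnj (a i) / 2:] ^ N" for i
    have q: "poly (q i) x = peak (cnj (a i) * x) ^ N" for i x
      by (simp add: q_def peak_def poly_power add_divide_distrib mult.commute)
    have "\<forall>T. \<exists>f. holomorphic_everywhere f \<and> (\<forall>z :: complex ^ 'n::{finite,linorder}.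
        f (theta_map m p z) = (\<Prod>j\<in>UNIV. poly (\<Sum>i\<in>T. q i) ((z $ j) ^ m)))"
      using prod_poly_factors_through_theta_map[OF \<open>p dvd m\<close>] by blast
    from choice[OF this] obtain g where g: "\<And>T. holomorphic_everywhere (g T)"
      "\<And>T (z :: complex ^ 'n::{finite,linorder}).
        g T (theta_map m p z) = (\<Prod>j\<in>UNIV. poly (\<Sum>i\<in>T. q i) ((z $ j) ^ m))"
      by blast
    define f where "f x = (\<Sum>T\<in>UNIV. (-1) ^ card (- T) * g T x) *
        (1 / 2 + cnj w0 / 2 * x $ Max UNIV) ^ N" for x
    have "holomorphic_everywhere f"
      unfolding f_def
      by (intro holomorphic_everywhere_mult holomorphic_everywhere_sum holomorphic_everywhere_power
          holomorphic_everywhere_add holomorphic_everywhere_const holomorphic_everywhere_nth g)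
    moreover have "f (theta_map m p z) = F N z" for z
    proof -
      have "f (theta_map m p z) =
          (\<Sum>T\<in>UNIV. (-1) ^ card (- T) * (\<Prod>j\<in>UNIV. \<Sum>i\<in>T. poly (q i) ((z $ j) ^ m))) *
          peak (cnj w0 * theta_map m p z $ Max UNIV) ^ N"
        by (simp add: f_def g poly_sum peak_def add_divide_distrib)
      also have "\<dots> = (\<Sum>\<phi> | surj \<phi>. \<Prod>j\<in>UNIV. poly (q (\<phi> j)) ((z $ j) ^ m)) *
          peak (cnj w0 * theta_map m p z $ Max UNIV) ^ N"
        by (simp only: permanent_eq_sum_prod_sum[of "\<lambda>i j. poly (q i) ((z $ j) ^ m)"])
      also have "\<dots> = F N z"
        by (simp add: F_def t_def q power_mult_distrib prod_power_distrib sum_distrib_right)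
      finally show ?thesis .
    qed
    ultimately show ?thesis by blast
  qed

  define K where "K = P \<inter> theta_map m p -` S"
  have "closed S" using bd by (simp add: closed_boundary_def)
  then have "compact K"
    unfolding K_def P_def
    by (intro compact_Int_closed compact_polydisc closed_vimage continuous_on_theta_map)
  have cont_t: "continuous_on K (t \<phi>)" for \<phi>
    unfolding t_def peak_def
    by (intro continuous_intros continuous_on_theta_map) auto
  have t_less: "norm (t \<phi> z) < 1" if "\<phi> \<in> {\<phi>. surj \<phi>}" "z \<in> K" for \<phi> z
  proof (rule ccontr)
    have z: "z \<in> P" "theta_map m p z \<in> S" using that by (auto simp: K_def)
    assume "\<not> norm (t \<phi> z) < 1"
    then have "norm (t \<phi> z) = 1" using t_le[OF z(1), of \<phi>] by simp
    then have "theta_map m p z = theta_map m p \<zeta>"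
      using t_eq_1[OF z(1)] that
      by (intro theta_map_eq_of_permuted_powers[of \<phi>]) (auto simp: a_def w0_def)
    then show False using z notin by simp
  qed
  have "\<exists>\<rho>. 0 \<le> \<rho> \<and> \<rho> < 1 \<and> (\<forall>\<phi>\<in>{\<phi>. surj \<phi>}. \<forall>z\<in>K. norm (t \<phi> z) \<le> \<rho>)"
    by (rule uniform_bound_on_compact[where g = t]) (fact \<open>compact K\<close> cont_t t_less)+
  then obtain \<rho> where \<rho>: "0 \<le> \<rho>" "\<rho> < 1"
    and t_le_\<rho>: "\<forall>\<phi>\<in>{\<phi>. surj \<phi>}. \<forall>z\<in>K. norm (t \<phi> z) \<le> \<rho>"
    by (elim exE conjE)
  define C where "C = real (card {\<phi> :: 'n \<Rightarrow> 'n. surj \<phi>})"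

  have F_le: "norm (F N \<zeta>) \<le> C * \<rho> ^ N" for N
  proof -
    obtain f where f: "holomorphic_everywhere f"
      "\<And>z :: complex ^ 'n::{finite,linorder}. f (theta_map m p z) = F N z"
      using F_factors by blast
    obtain x where x: "x \<in> S" "\<And>y. y \<in> Theta_closed m p \<Longrightarrow> norm (f y) \<le> norm (f x)"
      using bd holomorphic_everywhere_imp[OF f(1)] unfolding closed_boundary_def by blast
    have "x \<in> Theta_closed m p" using x bd by (auto simp: closed_boundary_def)
    then obtain z where z: "x = theta_map m p z" "z \<in> K"
      using x(1) by (auto simp: Theta_closed_def K_def P_def)
    have "theta_map m p \<zeta> \<in> Theta_closed m p" by (auto simp: Theta_closed_def \<zeta>)
    then have "norm (F N \<zeta>) \<le> norm (F N z)" using x(2) f(2) z by metis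
    also have "\<dots> \<le> (\<Sum>\<phi> | surj \<phi>. norm (t \<phi> z ^ N))" unfolding F_def by (rule norm_sum)
    also have "\<dots> \<le> (\<Sum>\<phi> :: 'n \<Rightarrow> 'n | surj \<phi>. \<rho> ^ N)"
      using t_le_\<rho> z(2) by (intro sum_mono) (simp add: norm_power power_mono)
    also have "\<dots> = C * \<rho> ^ N" by (simp add: C_def)
    finally show ?thesis .
  qed
  have \<rho>_lim: "(\<lambda>N. C * \<rho> ^ N) \<longlonglongrightarrow> 0"
    using tendsto_mult_right_zero[OF LIMSEQ_realpow_zero[OF \<rho>]] by simp
  have lim0: "(\<lambda>N. F N \<zeta>) \<longlonglongrightarrow> 0"
    by (rule Lim_null_comparison[OF always_eventually[OF allI[OF F_le]] \<rho>_lim])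

  define s :: "('n \<Rightarrow> 'n) set" where "s = {\<phi>. surj \<phi> \<and> t \<phi> \<zeta> = 1}"
  have \<zeta>P: "\<zeta> \<in> P" by (auto simp: P_def \<zeta>)
  have unit: "cnj x * x = 1" if "norm x = 1" for x :: complex
    using that by (simp add: mult.commute complex_norm_square[symmetric])
  have "(\<lambda>N. F N \<zeta>) \<longlonglongrightarrow> (\<Sum>\<phi> | surj \<phi>. if t \<phi> \<zeta> = 1 then 1 else 0)"
    unfolding F_def
  proof (rule tendsto_sum)
    fix \<phi> :: "'n \<Rightarrow> 'n"
    show "(\<lambda>N. t \<phi> \<zeta> ^ N) \<longlonglongrightarrow> (if t \<phi> \<zeta> = 1 then 1 else 0)"
    proof (cases "norm (t \<phi> \<zeta>) = 1")
      case True
      then have "t \<phi> \<zeta> = 1"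
        using t_eq_1[OF \<zeta>P True] by (simp add: t_def unit a1 w01 w0_def[symmetric])
      then show ?thesis by simp
    next
      case False
      then have "norm (t \<phi> \<zeta>) < 1" using t_le[OF \<zeta>P, of \<phi>] by simp
      moreover from False have "t \<phi> \<zeta> \<noteq> 1" by auto
      ultimately show ?thesis by (simp add: LIMSEQ_power_zero)
    qed
  qed
  also have "(\<Sum>\<phi> | surj \<phi>. if t \<phi> \<zeta> = 1 then 1 else 0) = (of_nat (card s) :: complex)"
    by (simp add: s_def sum.If_cases Int_def)
  finally have "of_nat (card s) = (0 :: complex)"
    using lim0 LIMSEQ_unique by blast
  moreover have "id \<in> s"
    by (simp add: s_def t_def a_def[symmetric] w0_def[symmetric] unit a1 w01)
  ultimately show False by auto
qed

lemma Theta_boundary_eq: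
  assumes "p dvd m"
  shows "(Theta_boundary m p :: (complex ^ 'n::{finite,linorder}) set) =
    theta_map m p ` {z. \<forall>j. norm (z $ j) = 1}"
  unfolding Theta_boundary_def Shilov_boundary_def
  by (rule Least_equality)
    (use torus_is_closed_boundary torus_subset_closed_boundary[OF assms] in auto)

section \<open>The degree of a finite Blaschke product\<close>

lemma infinite_punctured_ball: "infinite (ball (0 :: complex) 1 - {0})"
proof -
  have "infinite (ball (0 :: complex) 1)"
    using uncountable_ball[of 1 "0 :: complex"] countable_finite by auto
  then show ?thesis by simp
qed

lemma poly_eq_of_eq_on_infinite:
  fixes P Q :: "complex poly"
  assumes "infinite A" "\<And>z. z \<in> A \<Longrightarrow> poly P z = poly Q z"
  shows "P = Q"
proof (rule ccontr)
  assume "P \<noteq> Q"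
  then have "finite {z. poly (P - Q) z = 0}" by (intro poly_roots_finite) simp
  moreover have "A \<subseteq> {z. poly (P - Q) z = 0}" using assms(2) by auto
  ultimately show False using assms(1) finite_subset by blast
qed

definition disc_zeros :: "complex poly \<Rightarrow> nat"
  where "disc_zeros P = size (filter_mset (\<lambda>z. norm z < 1) (proots P))"

lemma disc_zeros_mult: "P \<noteq> 0 \<Longrightarrow> Q \<noteq> 0 \<Longrightarrow> disc_zeros (P * Q) = disc_zeros P + disc_zeros Q"
  by (simp add: disc_zeros_def proots_mult)

lemma disc_zeros_prod:
  fixes f :: "nat \<Rightarrow> complex poly"
  assumes "\<And>j. j < N \<Longrightarrow> f j \<noteq> 0"
  shows "disc_zeros (\<Prod>j<N. f j) = (\<Sum>j<N. disc_zeros (f j))"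
  using assms
proof (induction N)
  case 0
  show ?case by (simp add: disc_zeros_def)
next
  case (Suc N)
  then show ?case by (simp add: disc_zeros_mult less_Suc_eq)
qed

lemma disc_zeros_numerator: "norm a < 1 \<Longrightarrow> disc_zeros [:- a, 1:] = 1"
  by (simp add: disc_zeros_def)

lemma Blaschke_factor_denominator_nonzero:
  assumes "norm (a :: complex) < 1" "norm z < 1"
  shows "1 - cnj a * z \<noteq> 0"
proof
  assume "1 - cnj a * z = 0"
  then have "norm (cnj a * z) = 1" by simp
  moreover have "norm a * norm z < 1"
    using assms by (metis mult_strict_mono' norm_ge_zero mult_1)
  ultimately show False by (simp add: norm_mult)
qed

lemma disc_zeros_denominator:
  assumes "norm a < 1"
  shows "disc_zeros [:1, - cnj a:] = 0"
proof -
  have "poly [:1, - cnj a:] z \<noteq> 0" if "norm z < 1" for z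
    using Blaschke_factor_denominator_nonzero[OF assms that] by (simp add: mult.commute)
  moreover have "[:1, - cnj a:] \<noteq> 0" by simp
  ultimately show ?thesis
    unfolding disc_zeros_def by (auto simp: filter_mset_eq_conv)
qed

text \<open>
  The number of factors is the number of zeros in the disc. Clearing denominators makes the equality
  of two products a polynomial identity, and the denominators contribute no zeros in the disc.
\<close>

lemma finite_Blaschke_product_unique:
  assumes "finite_Blaschke_product f N" "finite_Blaschke_product f M"
  shows "N = M"
proof -
  obtain c a where c: "norm c = 1" and a: "\<And>j. j < N \<Longrightarrow> norm (a j) < 1"
    and f1: "\<And>z. z \<in> ball 0 1 \<Longrightarrow> f z = c * (\<Prod>j<N. (z - a j) / (1 - cnj (a j) * z))"
    using assms(1) unfolding finite_Blaschke_product_def by blast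
  obtain d b where d: "norm d = 1" and b: "\<And>j. j < M \<Longrightarrow> norm (b j) < 1"
    and f2: "\<And>z. z \<in> ball 0 1 \<Longrightarrow> f z = d * (\<Prod>j<M. (z - b j) / (1 - cnj (b j) * z))"
    using assms(2) unfolding finite_Blaschke_product_def by blast
  define num den where "num = (\<lambda>(a :: nat \<Rightarrow> complex) N. \<Prod>j<N. [:- a j, 1:])"
    and "den = (\<lambda>(a :: nat \<Rightarrow> complex) N. \<Prod>j<N. [:1, - cnj (a j):])"
  have nz: "num a N \<noteq> 0" "den a N \<noteq> 0" for a :: "nat \<Rightarrow> complex" and N
    unfolding num_def den_def by (auto simp: prod_zero_iff)
  have dz: "disc_zeros (num a N) = N" "disc_zeros (den a N) = 0"
    if "\<And>j. j < N \<Longrightarrow> norm (a j) < 1" for a N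
    unfolding num_def den_def using that
    by (simp_all add: disc_zeros_prod disc_zeros_numerator disc_zeros_denominator)
  have "smult c (num a N * den b M) = smult d (num b M * den a N)"
  proof (rule poly_eq_of_eq_on_infinite[OF infinite_punctured_ball])
    fix z :: complex assume "z \<in> ball 0 1 - {0}"
    then have z: "z \<in> ball 0 1" by simp
    have den_nz: "poly (den a N) z \<noteq> 0" if a: "\<And>j. j < N \<Longrightarrow> norm (a j) < 1" for a N
    proof -
      have "poly [:1, - cnj (a j):] z \<noteq> 0" if "j < N" for j
        using Blaschke_factor_denominator_nonzero[OF a[OF that], of z] z by (simp add: mult.commute)
      then show ?thesis
        unfolding den_def poly_prod by (simp add: prod_zero_iff del: poly_pCons)
    qed
    have "c * (poly (num a N) z / poly (den a N) z) = d * (poly (num b M) z / poly (den b M) z)"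
      using f1[OF z] f2[OF z] by (simp add: num_def den_def poly_prod prod_dividef mult.commute)
    then show "poly (smult c (num a N * den b M)) z = poly (smult d (num b M * den a N)) z"
      using den_nz[OF a] den_nz[OF b] by (simp add: field_simps)
  qed
  moreover have "disc_zeros (smult e P) = disc_zeros P" if "norm e = 1" for e P
  proof -
    have "e \<noteq> 0" using that by auto
    then show ?thesis by (simp add: disc_zeros_def)
  qed
  ultimately have "disc_zeros (num a N * den b M) = disc_zeros (num b M * den a N)"
    using c d by metis
  then show ?thesis by (simp add: disc_zeros_mult nz dz a b)
qed

lemma Blaschke_degree_eq: "finite_Blaschke_product f N \<Longrightarrow> Blaschke_degree f = N"
  unfolding Blaschke_degree_def using finite_Blaschke_product_unique by blast

text \<open>
  Each root \<open>r\<close> of \<open>D\<close> lies outside the closed disc and contributes the zero \<open>1 / cnj r\<close>; the missing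
  \<open>k - degree D\<close> factors are zeros at the origin.
\<close>

lemma finite_Blaschke_product_reflected:
  assumes deg: "degree D \<le> k" and nz: "\<And>z. z \<in> cball 0 1 \<Longrightarrow> poly D z \<noteq> 0"
  shows "finite_Blaschke_product (\<lambda>z. poly (reflected k D) z / poly D z) k"
proof -
  define d where "d = degree D"
  define L where "L = lead_coeff D"
  have "D \<noteq> 0" using nz[of 0] by auto
  then have L: "L \<noteq> 0" by (simp add: L_def)
  obtain r where r: "smult L (\<Prod>j<d. [:- r j, 1:]) = D"
    unfolding L_def d_def by (rule complex_poly_decompose')
  have polyD: "poly D z = L * (\<Prod>j<d. z - r j)" for z
    by (simp add: r[symmetric] poly_prod)
  have r1: "1 < norm (r j)" if "j < d" for j
  proof (rule ccontr)
    assume "\<not> 1 < norm (r j)"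
    then have "poly D (r j) \<noteq> 0" by (intro nz) simp
    then show False using that by (auto simp: polyD)
  qed
  have "reflected k D = smult (cnj L) (monom 1 (k - d) * (\<Prod>j<d. [:1, - cnj (r j):]))"
  proof (rule poly_eq_of_eq_on_infinite[OF infinite_punctured_ball])
    fix z :: complex assume "z \<in> ball 0 1 - {0}"
    then have z: "z \<noteq> 0" by simp
    have "poly (reflected k D) z = z ^ (k - d) * z ^ d * (cnj L * (\<Prod>j<d. 1 / z - cnj (r j)))"
      using deg by (simp add: poly_reflected[OF deg z] polyD d_def flip: power_add)
    also have "z ^ d * (\<Prod>j<d. 1 / z - cnj (r j)) = (\<Prod>j<d. z * (1 / z - cnj (r j)))"
      by (simp add: prod.distrib)
    then have "z ^ (k - d) * z ^ d * (cnj L * (\<Prod>j<d. 1 / z - cnj (r j))) =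
        cnj L * (z ^ (k - d) * (\<Prod>j<d. z * (1 / z - cnj (r j))))"
      by (simp add: mult_ac)
    also have "\<dots> = poly (smult (cnj L) (monom 1 (k - d) * (\<Prod>j<d. [:1, - cnj (r j):]))) z"
      using z by (simp add: poly_prod poly_monom algebra_simps)
    finally show "poly (reflected k D) z =
        poly (smult (cnj L) (monom 1 (k - d) * (\<Prod>j<d. [:1, - cnj (r j):]))) z" .
  qed
  then have polyR: "poly (reflected k D) z = cnj L * (z ^ (k - d) * (\<Prod>j<d. 1 - cnj (r j) * z))" for z
    by (simp add: poly_prod poly_monom mult.commute)
  define a where "a j = (if j < d then 1 / cnj (r j) else 0)" for j
  define c where "c = cnj L / L * (\<Prod>j<d. cnj (r j) / r j)"
  have "norm c = 1"
  proof -
    have "norm (\<Prod>j<d. cnj (r j) / r j) = (\<Prod>j<d. 1)"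
      unfolding prod_norm[symmetric] using r1 by (intro prod.cong) (auto simp: norm_divide dest!: r1)
    then show ?thesis using L by (simp add: c_def norm_mult norm_divide)
  qed
  moreover have "norm (a j) < 1" for j
    using r1[of j] by (simp add: a_def norm_divide divide_less_eq)
  moreover have "poly (reflected k D) z / poly D z = c * (\<Prod>j<k. (z - a j) / (1 - cnj (a j) * z))"
    if z: "z \<in> ball 0 1" for z
  proof -
    have fac: "(1 - cnj (r j) * z) / (z - r j) =
        cnj (r j) / r j * ((z - a j) / (1 - cnj (a j) * z))" if "j < d" for j
    proof -
      have "r j \<noteq> 0" "z - r j \<noteq> 0" "r j - z \<noteq> 0" using r1[OF that] z by auto
      then show ?thesis using that by (simp add: a_def divide_simps) (simp add: algebra_simps)
    qed
    have "{..<k} = {..<d} \<union> {d..<k}" using deg by (auto simp: d_def)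
    then have "(\<Prod>j<k. (z - a j) / (1 - cnj (a j) * z)) =
        (\<Prod>j<d. (z - a j) / (1 - cnj (a j) * z)) * (\<Prod>j\<in>{d..<k}. (z - a j) / (1 - cnj (a j) * z))"
      by (simp add: prod.union_disjoint ivl_disj_int)
    also have "(\<Prod>j\<in>{d..<k}. (z - a j) / (1 - cnj (a j) * z)) = z ^ (k - d)"
      by (simp add: a_def)
    finally have "c * (\<Prod>j<k. (z - a j) / (1 - cnj (a j) * z)) =
        cnj L / L * z ^ (k - d) * ((\<Prod>j<d. cnj (r j) / r j) * (\<Prod>j<d. (z - a j) / (1 - cnj (a j) * z)))"
      by (simp add: c_def)
    also have "(\<Prod>j<d. cnj (r j) / r j) * (\<Prod>j<d. (z - a j) / (1 - cnj (a j) * z)) =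
        (\<Prod>j<d. (1 - cnj (r j) * z) / (z - r j))"
      unfolding prod.distrib[symmetric] by (intro prod.cong) (auto simp: fac)
    finally show ?thesis by (simp add: polyR polyD prod_dividef)
  qed
  ultimately show ?thesis unfolding finite_Blaschke_product_def by blast
qed

section \<open>Rational inner functions from polynomials\<close>

lemma norm_le_1_of_power:
  fixes x :: complex
  assumes "0 < m" "norm (x ^ m) \<le> 1"
  shows "norm x \<le> 1"
proof (rule ccontr)
  assume "\<not> norm x \<le> 1"
  then have "1 < norm x ^ m" using one_less_power[of "norm x" m] assms(1) by simp
  then show False using assms(2) by (simp add: norm_power)
qed

lemma norm_eq_1_of_power:
  fixes x :: complex
  assumes "0 < m" "norm (x ^ m) = 1"
  shows "norm x = 1"
  using power_eq_imp_eq_base[of "norm x" m 1] assms by (simp add: norm_power)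

lemma poly_reflected_on_circle:
  assumes "degree h \<le> d" "norm z = 1"
  shows "poly (reflected d h) z = z ^ d * cnj (poly h z)"
proof -
  have "z \<noteq> 0" using assms(2) by auto
  moreover have "cnj z * z = 1"
    using assms(2) by (simp add: mult.commute complex_norm_square[symmetric])
  then have "1 / cnj z = z" using \<open>z \<noteq> 0\<close> by (simp add: field_simps)
  ultimately show ?thesis using poly_reflected[OF assms(1), of z] by simp
qed

theorem theorem4p9:
  fixes m p n k :: nat
    and E :: "nat \<Rightarrow> complex poly"
    and D :: "complex poly"
    and \<theta> :: "nat \<Rightarrow> complex \<Rightarrow> complex"
    and \<gamma> :: "nat \<Rightarrow> complex"
    and \<Theta> :: "complex \<Rightarrow> complex ^ 'n::{finite,linorder}"
  assumes "n = CARD('n)" and "2 \<le> n"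
    and "0 < m" and "0 < p" and "p dvd m"
    and "\<forall>i\<in>{1..n-1}. degree (E i) \<le> p * k"
    and "degree D \<le> k"
    and "\<forall>z\<in>cball 0 1. poly D z \<noteq> 0"
    and "\<forall>i\<in>{1..n-1}. E i = reflected (p * k) (E (n - i))"
    and "\<forall>i\<in>{1..n-1}. \<forall>z. \<theta> i z = poly (E i) z / poly D z ^ p"
    and "\<forall>z. \<theta> n z = poly (reflected k D) z / poly D z"
    and "\<forall>i\<in>{1..n-1}. \<gamma> i = of_nat (n - i) / of_nat n"
    and "\<forall>z\<in>sphere 0 1. (\<lambda>i\<in>{1..n-1}. \<gamma> i * \<theta> i z) \<in> sym_polydisc (n - 1)"
    and "\<forall>z. \<Theta> z = (\<chi> j. \<theta> (coord j) z)"
  shows "rational_Theta_inner m p \<Theta> \<and> Theta_degree p \<Theta> \<le> p * k"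
proof -
  note n = assms(1) and n2 = assms(2) and m = assms(3) and p = assms(4) and pm = assms(5)
  have deg_E: "degree (E i) \<le> p * k" if "i \<in> {1..n-1}" for i using assms(6) that by blast
  have deg_D: "degree D \<le> k" by (fact assms(7))
  have D_nz: "poly D z \<noteq> 0" if "norm z \<le> 1" for z using assms(8) that by simp
  have E_refl: "E i = reflected (p * k) (E (n - i))" if "i \<in> {1..n-1}" for i
    using assms(9) that by blast
  have \<theta>_low: "\<theta> i z = poly (E i) z / poly D z ^ p" if "i \<in> {1..n-1}" for i z
    using assms(10) that by blast
  have \<theta>_n: "\<theta> n z = poly (reflected k D) z / poly D z" for z using assms(11) by blast
  have \<gamma>: "\<gamma> i = of_nat (n - i) / of_nat n" if "i \<in> {1..n-1}" for i using assms(12) that by blast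
  have \<Theta>: "\<Theta> z = (\<chi> j. \<theta> (coord j) z)" for z using assms(14) by blast

  have rational: "\<exists>P Q. (\<forall>z. norm z \<le> 1 \<longrightarrow> poly Q z \<noteq> 0) \<and> \<theta> i = (\<lambda>z. poly P z / poly Q z)"
    if "1 \<le> i" "i \<le> n" for i
  proof (cases "i = n")
    case True
    then show ?thesis using \<theta>_n D_nz by (intro exI[of _ "reflected k D"] exI[of _ D]) auto
  next
    case False
    then have "i \<in> {1..n-1}" using that by auto
    then show ?thesis
      using \<theta>_low D_nz by (intro exI[of _ "E i"] exI[of _ "D ^ p"]) (auto simp: poly_power)
  qed
  have \<theta>_cont: "continuous_on (cball 0 1) (\<theta> i)" and \<theta>_hol: "\<theta> i holomorphic_on ball 0 1"
    and \<theta>_isCont: "norm z = 1 \<Longrightarrow> isCont (\<theta> i) z" if i: "1 \<le> i" "i \<le> n" for i z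
  proof -
    obtain P Q where PQ: "\<And>z. norm z \<le> 1 \<Longrightarrow> poly Q z \<noteq> 0" and eq: "\<theta> i = (\<lambda>z. poly P z / poly Q z)"
      using rational[OF i] by blast
    show "continuous_on (cball 0 1) (\<theta> i)" unfolding eq using PQ by (intro continuous_intros) auto
    show "\<theta> i holomorphic_on ball 0 1" unfolding eq using PQ by (intro holomorphic_intros) auto
    show "norm z = 1 \<Longrightarrow> isCont (\<theta> i) z" unfolding eq using PQ by (intro continuous_intros) auto
  qed

  \<comment> \<open>Signed by \<open>(-1)\<^sup>i\<close>, these are the coefficients of the monic polynomial whose roots are the
      \<open>m\<close>-th powers of the coordinates of a preimage of \<open>\<Theta> z\<close>.\<close>
  define c where "c i z = (if i = 0 then 1 else if i < n then \<theta> i z else \<theta> n z ^ p)" for i z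
  have circle: "\<exists>u :: 'n \<Rightarrow> complex. (\<forall>j. norm (u j) = 1) \<and> (\<forall>i\<le>CARD('n). c i z = elem_sym UNIV i u)"
    if z: "norm z = 1" for z
  proof -
    obtain u :: "'n \<Rightarrow> complex" where u: "\<And>i. i \<le> n \<Longrightarrow> c i z = elem_sym UNIV i u"
      using exists_elem_sym[of "\<lambda>i. c i z", where 'n = 'n] unfolding n c_def by auto
    have D0: "poly D z \<noteq> 0" using D_nz z by simp
    have \<theta>_n_z: "\<theta> n z = z ^ k * cnj (poly D z) / poly D z"
      by (simp add: \<theta>_n poly_reflected_on_circle[OF deg_D z])
    then have \<theta>_n_norm: "norm (\<theta> n z) = 1"
      using D0 z by (simp add: norm_mult norm_divide norm_power)
    have c_n: "c n z = \<theta> n z ^ p" using n2 by (simp add: c_def)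
    have c_n_norm: "norm (c n z) = 1" by (simp add: c_n norm_power \<theta>_n_norm)
    \<comment> \<open>On the circle, \<open>E\<^sub>i = E\<^sub>n\<^sub>-\<^sub>i\<^sup>~\<close> says that this polynomial is self-inversive.\<close>
    have self_inv: "c i z = cnj (c (n - i) z) * c n z" if "i \<le> n" for i
    proof -
      have "i = 0 \<or> i = n \<or> (1 \<le> i \<and> i \<le> n - 1 \<and> 1 \<le> n - i \<and> n - i \<le> n - 1)"
        using that n2 by linarith
      then consider "i = 0" | "i = n" | "i \<in> {1..n-1}" "n - i \<in> {1..n-1}"
        unfolding atLeastAtMost_iff by blast
      then show ?thesis
      proof cases
        case 1
        then show ?thesis
          using c_n_norm by (simp add: c_def mult.commute complex_norm_square[symmetric])
      next
        case 2
        then show ?thesis by (simp add: c_def)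
      next
        case 3
        have "poly (E i) z = z ^ (p * k) * cnj (poly (E (n - i)) z)"
          using poly_reflected_on_circle[OF deg_E[OF 3(2)] z] E_refl[OF 3(1)] by simp
        moreover have "i \<noteq> 0" "i < n" "n - i \<noteq> 0" "n - i < n" using 3 n2 by auto
        then have c_low: "c i z = \<theta> i z" "c (n - i) z = \<theta> (n - i) z" by (simp_all add: c_def)
        ultimately have "c i z = z ^ (p * k) * cnj (poly (E (n - i)) z) / poly D z ^ p"
          by (simp add: \<theta>_low[OF 3(1)])
        also have "\<dots> = cnj (poly (E (n - i)) z / poly D z ^ p) * (z ^ k * cnj (poly D z) / poly D z) ^ p"
          using D0 by (simp add: power_divide power_mult_distrib mult.commute[of p] power_mult)
        also have "poly (E (n - i)) z / poly D z ^ p = c (n - i) z"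
          by (simp add: c_low \<theta>_low[OF 3(2)])
        finally show ?thesis by (simp only: c_n \<theta>_n_z)
      qed
    qed
    \<comment> \<open>The weights \<open>\<gamma>\<^sub>i\<close> are those of differentiation: \<open>b\<close> lists the critical points.\<close>
    have "(\<lambda>i\<in>{1..n-1}. \<gamma> i * \<theta> i z) \<in> sym_polydisc (n - 1)"
      using assms(13) z by simp
    then obtain b where b: "b \<in> {1..n-1} \<rightarrow>\<^sub>E cball 0 1"
      and b_eq: "(\<lambda>i\<in>{1..n-1}. \<gamma> i * \<theta> i z) = (\<lambda>i\<in>{1..n-1}. elem_sym {1..n-1} i b)"
      unfolding sym_polydisc_def mem_Collect_eq by blast
    have "norm (u j) = 1" for j
    proof (rule roots_on_circle_of_critical_points_in_disc[OF n])
      show "norm (elem_sym UNIV n u) = 1" using c_n_norm u[of n] by simp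
      show "elem_sym UNIV i u = cnj (elem_sym UNIV (n - i) u) * elem_sym UNIV n u" if "i \<le> n" for i
        using self_inv[OF that] u[OF that] u[of n] u[of "n - i"] by simp
      show "norm (b j) \<le> 1" if "j \<in> {1..n-1}" for j
        using b that by (auto simp: PiE_def Pi_def)
      show "of_nat (n - i) / of_nat n * elem_sym UNIV i u = elem_sym {1..n-1} i b" if "i \<le> n - 1" for i
      proof (cases "i = 0")
        case True
        then show ?thesis using n2 by simp
      next
        case False
        then have i: "i \<in> {1..n-1}" using that by simp
        have "i < n" using that n2 by linarith
        then have "elem_sym UNIV i u = \<theta> i z" using u[of i] False by (simp add: c_def)
        then show ?thesis using fun_cong[OF b_eq, of i] i by (simp add: \<gamma>)
      qed
    qed
    then show ?thesis using u n by blast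
  qed

  have c_cont: "continuous_on (cball 0 1) (c i)" and c_hol: "c i holomorphic_on ball 0 1" for i
  proof -
    have "c i = (\<lambda>z. if i = 0 then 1 else if i < n then \<theta> i z else \<theta> n z ^ p)"
      by (auto simp: c_def)
    then show "continuous_on (cball 0 1) (c i)" "c i holomorphic_on ball 0 1"
      using n2 by (cases "i = 0"; cases "i < n";
          auto intro!: continuous_intros holomorphic_intros \<theta>_cont \<theta>_hol)+
  qed
  have lift: "\<exists>w :: complex ^ 'n::{finite,linorder}. (\<forall>j. (w $ j) ^ m = u j) \<and> \<Theta> z = theta_map m p w"
    if u: "\<forall>i\<le>CARD('n). c i z = elem_sym UNIV i u" for z u
  proof -
    have "\<theta> i z = elem_sym UNIV i u" if "1 \<le> i" "i < CARD('n)" for i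
      using spec[OF u, of i] that n by (simp add: c_def)
    moreover have "\<theta> (CARD('n)) z ^ p = elem_sym UNIV (CARD('n)) u"
      using spec[OF u, of "CARD('n)"] n n2 by (simp add: c_def)
    ultimately show ?thesis
      using theta_map_of_roots[OF m p pm, of "\<lambda>i. \<theta> i z" u] \<Theta> by metis
  qed

  have interior: "\<Theta> z \<in> Theta_closed m p" if "z \<in> ball 0 1" for z
  proof -
    have "\<exists>u :: 'n \<Rightarrow> complex. (\<forall>j. norm (u j) \<le> 1) \<and> (\<forall>i\<le>CARD('n). c i z = elem_sym UNIV i u)"
    proof (rule roots_in_disc_of_roots_on_circle[OF _ c_cont c_hol])
      show "\<exists>u :: 'n \<Rightarrow> complex. (\<forall>j. norm (u j) \<le> 1) \<and> (\<forall>i\<le>CARD('n). c i y = elem_sym UNIV i u)"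
        if "y \<in> sphere 0 1" for y
        using circle[of y] that order.refl by (metis mem_sphere_0)
    qed (use that in \<open>auto simp: c_def\<close>)
    then obtain u :: "'n \<Rightarrow> complex" where u: "\<And>j. norm (u j) \<le> 1"
        "\<forall>i\<le>CARD('n). c i z = elem_sym UNIV i u" by blast
    obtain w :: "complex ^ 'n::{finite,linorder}"
      where w: "\<And>j. (w $ j) ^ m = u j" "\<Theta> z = theta_map m p w" using lift[OF u(2)] by blast
    have "norm (w $ j) \<le> 1" for j by (rule norm_le_1_of_power[OF m]) (simp add: w u)
    then show ?thesis unfolding w Theta_closed_def by auto
  qed
  have boundary: "\<Theta> z \<in> Theta_boundary m p" if z: "norm z = 1" for z
  proof -
    obtain u :: "'n \<Rightarrow> complex" where u: "\<And>j. norm (u j) = 1"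
        "\<forall>i\<le>CARD('n). c i z = elem_sym UNIV i u" using circle[OF z] by blast
    obtain w :: "complex ^ 'n::{finite,linorder}"
      where w: "\<And>j. (w $ j) ^ m = u j" "\<Theta> z = theta_map m p w" using lift[OF u(2)] by blast
    have "norm (w $ j) = 1" for j by (rule norm_eq_1_of_power[OF m]) (simp add: w u)
    then show ?thesis unfolding w Theta_boundary_eq[OF pm] by auto
  qed
  have \<Theta>_nth: "(\<lambda>z. \<Theta> z $ j) = \<theta> (coord j)" for j by (auto simp: \<Theta>)
  have radial: "((\<lambda>r. \<Theta> (complex_of_real r * cis t)) \<longlongrightarrow> \<Theta> (cis t)) (at_left 1)" for t
  proof -
    have "((\<lambda>r. complex_of_real r * cis t) \<longlongrightarrow> cis t) (at_left 1)"
      by (auto intro!: tendsto_eq_intros)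
    then have "((\<lambda>r. \<theta> (coord j) (complex_of_real r * cis t)) \<longlongrightarrow> \<theta> (coord j) (cis t)) (at_left 1)"
      for j :: 'n
      using coord_le[of j] coord_ge[of j] n
      by (intro isCont_tendsto_compose[OF \<theta>_isCont]) auto
    then show ?thesis unfolding \<Theta> by (intro tendsto_vec_lambda)
  qed
  have "Theta_inner m p \<Theta>"
    unfolding Theta_inner_def
  proof (intro conjI allI)
    show "(\<lambda>z. \<Theta> z $ j) holomorphic_on ball 0 1" for j
      unfolding \<Theta>_nth using coord_le[of j] coord_ge[of j] n by (intro \<theta>_hol) auto
    show "\<Theta> ` ball 0 1 \<subseteq> Theta_closed m p" using interior by blast
    have "\<exists>l\<in>Theta_boundary m p. ((\<lambda>r. \<Theta> (complex_of_real r * cis t)) \<longlongrightarrow> l) (at_left 1)" for t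
      using radial[of t] boundary[of "cis t"] by auto
    then show "AE t in lebesgue_on {0..2 * pi}. \<exists>l\<in>Theta_boundary m p.
        ((\<lambda>r. \<Theta> (complex_of_real r * cis t)) \<longlongrightarrow> l) (at_left 1)"
      by (rule AE_I2)
  qed
  moreover have "rational_on_disc (\<lambda>z. \<Theta> z $ j)" for j
  proof -
    have "1 \<le> coord j" "coord j \<le> n" using coord_ge coord_le n by auto
    then obtain P Q where PQ: "\<And>z. norm z \<le> 1 \<Longrightarrow> poly Q z \<noteq> 0"
        "\<theta> (coord j) = (\<lambda>z. poly P z / poly Q z)"
      using rational by blast
    then show ?thesis
      unfolding \<Theta>_nth rational_on_disc_def by (intro exI[of _ P] exI[of _ Q]) simp
  qed
  moreover have "Theta_degree p \<Theta> = p * k"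
  proof -
    have "(\<lambda>z. \<Theta> z $ Max UNIV) = (\<lambda>z. poly (reflected k D) z / poly D z)"
      unfolding \<Theta>_nth coord_Max by (auto simp: \<theta>_n n[symmetric])
    moreover have "finite_Blaschke_product (\<lambda>z. poly (reflected k D) z / poly D z) k"
      by (rule finite_Blaschke_product_reflected[OF deg_D]) (simp add: D_nz)
    ultimately show ?thesis
      by (simp add: Theta_degree_def Blaschke_degree_eq)
  qed
  ultimately show ?thesis by (simp add: rational_Theta_inner_def)
qed

end
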